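(* Suppose $\mathcal{T}=(V,E)$ is a countably infinite rooted and leafless directed tree, $\boldsymbol\lambda=\{\lambda_v\}_{v\in V^\circ}\subseteq(0,\infty)$, and the weighted shift $S_{\boldsymbol\lambda}$ on $\mathcal{T}$ with weights $\boldsymbol\lambda$ is a bounded operator on $\ell^2(V)$. Then $$\mathscr{M}(\boldsymbol\lambda)=\overline{\{p(S_{\boldsymbol\lambda})\colon p\in\mathbb{C}[X]\}}^{\mathrm{SOT}}=\overline{\{p(S_{\boldsymbol\lambda})\colon p\in\mathbb{C}[X]\}}^{\mathrm{WOT}},$$ where the closures are taken in $\mathbf{B}(\ell^2(V))$ in the strong and in the weak operator topology, respectively.
   Context: $\mathbb{N}_0=\{0,1,2,\dots\}$. A directed tree $\mathcal{T}=(V,E)$ is a directed graph with nonempty vertex set $V$ and edge set $E\subseteq\{(u,v)\in V\times V\colon u\ne v\}$ which is connected (as an undirected graph), has no directed circuits, and in which every $v\in V$ has at most one parent, i.e. a vertex $\mathsf{par}(v)$ with $(\mathsf{par}(v),v)\in E$. Put $\mathsf{Chi}(u)=\{v\in V\colon (u,v)\in E\}$. A root is a vertex without parent (unique if it exists, denoted $\mathsf{root}$); $\mathcal{T}$ is rooted if the root exists, and then $V^\circ=V\setminus\{\mathsf{root}\}$. $\mathcal{T}$ is leafless if $\mathsf{Chi}(v)\neq\emptyset$ for all $v\in V$. $\mathsf{par}^k$ is the $k$-fold composition of the partial function $\mathsf{par}$ ($\mathsf{par}^0$ is the identity). For rooted $\mathcal{T}$ and $v\in V$, $|v|$ is the unique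 $k\in\mathbb{N}_0$ with $\mathsf{par}^k(v)=\mathsf{root}$. The weighted shift $S_{\boldsymbol\lambda}$ on $\mathcal{T}$ with weights $\boldsymbol\lambda$ is given by $(S_{\boldsymbol\lambda}f)(v)=\lambda_v f(\mathsf{par}(v))$ for $v\in V^\circ$ and $(S_{\boldsymbol\lambda}f)(\mathsf{root})=0$, $f\in\ell^2(V)$; it is a bounded operator on $\ell^2(V)$ when $\sup_{v\in V}\sum_{u\in\mathsf{Chi}(v)}|\lambda_u|^2<\infty$. If $\mathsf{par}^k(v)=u$, set $\lambda_{u|v}=\prod_{n=0}^{k-1}\lambda_{\mathsf{par}^n(v)}$ (equal to $1$ if $k=0$). For $\hat\varphi\colon\mathbb{N}_0\to\mathbb{C}$ let $(\varGamma_{\hat\varphi}f)(v)=\sum_{k=0}^{|v|}\lambda_{\mathsf{par}^k(v)|v}\,\hat\varphi(k)f(\mathsf{par}^k(v))$ for $f\in\mathbb{C}^V$, $v\in V$. The multiplication operator $M_{\hat\varphi}$ in $\ell^2(V)$ has domain $\mathcal{D}(M_{\hat\varphi})=\{f\in\ell^2(V)\colon\varGamma_{\hat\varphi}f\in\ell^2(V)\}$ and $M_{\hat\varphi}f=\varGamma_{\hat\varphi}f$. It is closed, so it is bounded if its domain is $\ell^2(V)$. $\mathcal{M}(\boldsymbol\lambda)$ is the set of all $\hat\varphi\colon\mathbb{N}_0\to\mathbb{C}$ with $\mathcal{D}(M_{\hat\varphi})=\ell^2(V)$, and $\mathscr{M}(\boldsymbol\lambda)=\{M_{\hat\varphi}\colon\hat\varphi\in\mathcal{M}(\boldsymbol\lambda)\}\subseteq\mathbf{B}(\ell^2(V))$,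 where $\mathbf{B}(\ell^2(V))$ is the algebra of bounded operators on $\ell^2(V)$. *)

theory Defs
  imports "HOL-Analysis.Analysis" "HOL-Computational_Algebra.Polynomial"
begin

section \<open>Directed trees\<close>

locale directed_tree =
  fixes V :: "'v set" and E :: "('v \<times> 'v) set"
  assumes nonempty: "V \<noteq> {}"
    and edges: "E \<subseteq> {(u, v) \<in> V \<times> V. u \<noteq> v}"
    and connected: "\<And>u v. u \<in> V \<Longrightarrow> v \<in> V \<Longrightarrow> (u, v) \<in> (E \<union> E\<inverse>)\<^sup>*"
    and no_circuits: "acyclic E"
    and parent_unique: "\<And>v. v \<in> V \<Longrightarrow> \<exists>\<^sub>\<le>\<^sub>1 u. (u, v) \<in> E"

definition par :: "('v \<times> 'v) set \<Rightarrow> 'v \<rightharpoonup> 'v"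
  where "par E v = (if \<exists>u. (u, v) \<in> E then Some (THE u. (u, v) \<in> E) else None)"

primrec par_pow :: "('v \<times> 'v) set \<Rightarrow> nat \<Rightarrow> 'v \<rightharpoonup> 'v"
  where "par_pow E 0 = Some"
  | "par_pow E (Suc k) = par E \<circ>\<^sub>m par_pow E k"

definition Chi :: "'v set \<Rightarrow> ('v \<times> 'v) set \<Rightarrow> 'v \<Rightarrow> 'v set"
  where "Chi V E u = {v \<in> V. (u, v) \<in> E}"

definition is_root :: "'v set \<Rightarrow> ('v \<times> 'v) set \<Rightarrow> 'v \<Rightarrow> bool"
  where "is_root V E r \<longleftrightarrow> r \<in> V \<and> par E r = None"

definition rooted :: "'v set \<Rightarrow> ('v \<times> 'v) set \<Rightarrow> bool"
  where "rooted V E \<longleftrightarrow> (\<exists>r. is_root V E r)"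

definition tree_root :: "'v set \<Rightarrow> ('v \<times> 'v) set \<Rightarrow> 'v"
  where "tree_root V E = (THE r. is_root V E r)"

definition leafless :: "'v set \<Rightarrow> ('v \<times> 'v) set \<Rightarrow> bool"
  where "leafless V E \<longleftrightarrow> (\<forall>v\<in>V. Chi V E v \<noteq> {})"

definition depth :: "'v set \<Rightarrow> ('v \<times> 'v) set \<Rightarrow> 'v \<Rightarrow> nat"
  where "depth V E v = (THE k. par_pow E k v = Some (tree_root V E))"

lemma (in directed_tree) par_eq_Some_iff: "par E v = Some u \<longleftrightarrow> (u, v) \<in> E"
proof -
  have "w = u" if "(u, v) \<in> E" "(w, v) \<in> E" for u w
    using parent_unique[of v] edges that by (auto simp: Uniq_def)
  then show ?thesis
    by (simp add: par_def) (metis theI)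
qed

lemma (in directed_tree) ex_depth_root:
  assumes r: "is_root V E r" and v: "v \<in> V"
  shows "\<exists>k. par_pow E k v = Some r"
proof -
  have "(r, v) \<in> (E \<union> E\<inverse>)\<^sup>*"
    using connected r v by (auto simp: is_root_def)
  then show ?thesis
  proof (induction rule: rtrancl_induct)
    case base
    have "par_pow E 0 r = Some r" by simp
    then show ?case by blast
  next
    case (step y z)
    then obtain k where k: "par_pow E k y = Some r" by blast
    have shift: "par_pow E (Suc m) a = par_pow E m b" if "par E a = Some b" for m a b
      using that by (induction m) (simp_all add: map_comp_def)
    from step.hyps(2) show ?case
    proof
      assume "(y, z) \<in> E"
      then show ?thesis using shift[of z y k] k par_eq_Some_iff by metis
    next
      assume "(y, z) \<in> E\<inverse>"
      then have p: "par E y = Some z" by (simp add: par_eq_Some_iff)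
      show ?thesis
      proof (cases k)
        case 0
        then show ?thesis using k p r by (simp add: is_root_def)
      next
        case (Suc m)
        then show ?thesis using shift[OF p, of m] k by metis
      qed
    qed
  qed
qed

lemma par_pow_root_unique:
  assumes "par_pow E k v = Some r" "par_pow E l v = Some s" "par E r = None" "par E s = None"
  shows "k = l \<and> r = s"
proof -
  have none: "par_pow E (Suc (m + n)) v = None"
    if "par_pow E m v = Some t" "par E t = None" for m n t
    using that by (induction n) (simp_all add: map_comp_def)
  have "\<not> k < l" using none[of k r] assms by (metis less_iff_Suc_add option.distinct(1))
  moreover have "\<not> l < k" using none[of l s] assms by (metis less_iff_Suc_add option.distinct(1))
  ultimately show ?thesis using assms by auto
qed

lemma (in directed_tree) is_root_unique:
  assumes "is_root V E r" "is_root V E s"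
  shows "r = s"
proof -
  obtain k where "par_pow E k r = Some s"
    using ex_depth_root assms by (meson is_root_def)
  then show ?thesis
    using par_pow_root_unique[of E 0 r r k s] assms by (auto simp: is_root_def)
qed

lemma (in directed_tree) is_root_tree_root: "rooted V E \<Longrightarrow> is_root V E (tree_root V E)"
  unfolding rooted_def tree_root_def using is_root_unique by (metis the_equality)

lemma (in directed_tree) depth_unique:
  assumes "rooted V E" "v \<in> V"
  shows "\<exists>!k. par_pow E k v = Some (tree_root V E)"
proof -
  have r: "is_root V E (tree_root V E)"
    using assms(1) by (rule is_root_tree_root)
  then obtain k where k: "par_pow E k v = Some (tree_root V E)"
    using ex_depth_root assms(2) by blast
  show ?thesis
    using k par_pow_root_unique[OF _ k] r unfolding is_root_def by blast
qed


section \<open>The Hilbert space of square-summable functions on a set\<close>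

text \<open>Functions on \<open>V\<close> are represented by functions that vanish outside \<open>V\<close>.\<close>

definition ell2 :: "'v set \<Rightarrow> ('v \<Rightarrow> complex) set"
  where "ell2 V = {f. (\<forall>v. v \<notin> V \<longrightarrow> f v = 0) \<and> (\<lambda>v. (cmod (f v))\<^sup>2) summable_on V}"

definition ell2_norm :: "'v set \<Rightarrow> ('v \<Rightarrow> complex) \<Rightarrow> real"
  where "ell2_norm V f = sqrt (\<Sum>\<^sub>\<infinity>v\<in>V. (cmod (f v))\<^sup>2)"

definition ell2_inner :: "'v set \<Rightarrow> ('v \<Rightarrow> complex) \<Rightarrow> ('v \<Rightarrow> complex) \<Rightarrow> complex"
  where "ell2_inner V f g = (\<Sum>\<^sub>\<infinity>v\<in>V. f v * cnj (g v))"


section \<open>Bounded operators and operator topologies\<close>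

text \<open>Operators are extensional, that is, \<^const>\<open>undefined\<close> outside their domain, so that equality
  of operators is equality of functions.\<close>

definition bounded_ops :: "'v set \<Rightarrow> (('v \<Rightarrow> complex) \<Rightarrow> ('v \<Rightarrow> complex)) set"
  where "bounded_ops V = {T \<in> ell2 V \<rightarrow>\<^sub>E ell2 V.
    (\<forall>f\<in>ell2 V. \<forall>g\<in>ell2 V. T (\<lambda>v. f v + g v) = (\<lambda>v. T f v + T g v)) \<and>
    (\<forall>f\<in>ell2 V. \<forall>c. T (\<lambda>v. c * f v) = (\<lambda>v. c * T f v)) \<and>
    (\<exists>C. \<forall>f\<in>ell2 V. ell2_norm V (T f) \<le> C * ell2_norm V f)}"

text \<open>Both topologies are generated by the balls of their defining families of seminorms,
  \<open>T \<mapsto> \<parallel>T f\<parallel>\<close> and \<open>T \<mapsto> \<bar>\<langle>T f, g\<rangle>\<bar>\<close> respectively.\<close>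

definition SOT :: "'v set \<Rightarrow> (('v \<Rightarrow> complex) \<Rightarrow> ('v \<Rightarrow> complex)) topology"
  where "SOT V = topology_generated_by
    {{T \<in> bounded_ops V. ell2_norm V (\<lambda>v. T f v - A f v) < e} | A f e.
       A \<in> bounded_ops V \<and> f \<in> ell2 V \<and> e > 0}"

definition WOT :: "'v set \<Rightarrow> (('v \<Rightarrow> complex) \<Rightarrow> ('v \<Rightarrow> complex)) topology"
  where "WOT V = topology_generated_by
    {{T \<in> bounded_ops V. cmod (ell2_inner V (\<lambda>v. T f v - A f v) g) < e} | A f g e.
       A \<in> bounded_ops V \<and> f \<in> ell2 V \<and> g \<in> ell2 V \<and> e > 0}"

lemma zero_in_ell2: "(\<lambda>v. 0) \<in> ell2 V"
  by (simp add: ell2_def)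

lemma topspace_SOT: "topspace (SOT V) = bounded_ops V"
proof -
  have "T \<in> topspace (SOT V)" if T: "T \<in> bounded_ops V" for T
  proof -
    let ?z = "\<lambda>v. 0 :: complex"
    let ?U = "{S \<in> bounded_ops V. ell2_norm V (\<lambda>v. S ?z v - T ?z v) < 1}"
    have "T \<in> ?U"
      by (simp add: T ell2_norm_def)
    then show ?thesis
      unfolding SOT_def topology_generated_by_topspace
      by (intro UnionI[of ?U] CollectI exI[of _ T] exI[of _ ?z] exI[of _ 1] conjI refl)
        (simp_all add: T zero_in_ell2 ell2_norm_def)
  qed
  moreover have "topspace (SOT V) \<subseteq> bounded_ops V"
    unfolding SOT_def topology_generated_by_topspace by (rule Union_least) auto
  ultimately show ?thesis by blast
qed

lemma topspace_WOT: "topspace (WOT V) = bounded_ops V"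
proof -
  have "T \<in> topspace (WOT V)" if T: "T \<in> bounded_ops V" for T
  proof -
    let ?z = "\<lambda>v. 0 :: complex"
    let ?U = "{S \<in> bounded_ops V. cmod (ell2_inner V (\<lambda>v. S ?z v - T ?z v) ?z) < 1}"
    have "T \<in> ?U"
      by (simp add: T ell2_inner_def)
    then show ?thesis
      unfolding WOT_def topology_generated_by_topspace
      by (intro UnionI[of ?U] CollectI exI[of _ T] exI[of _ ?z] exI[of _ 1] conjI refl)
        (simp_all add: T zero_in_ell2 ell2_inner_def)
  qed
  moreover have "topspace (WOT V) \<subseteq> bounded_ops V"
    unfolding WOT_def topology_generated_by_topspace by (rule Union_least) auto
  ultimately show ?thesis by blast
qed

definition poly_op ::
    "'v set \<Rightarrow> (('v \<Rightarrow> complex) \<Rightarrow> ('v \<Rightarrow> complex)) \<Rightarrow> complex poly \<Rightarrow> ('v \<Rightarrow> complex) \<Rightarrow> ('v \<Rightarrow> complex)"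
  where "poly_op V T p = (\<lambda>f\<in>ell2 V. \<lambda>v. \<Sum>i\<le>degree p. coeff p i * (T ^^ i) f v)"


section \<open>Weighted shifts and multiplication operators\<close>

definition weighted_shift ::
    "'v set \<Rightarrow> ('v \<times> 'v) set \<Rightarrow> ('v \<Rightarrow> real) \<Rightarrow> ('v \<Rightarrow> complex) \<Rightarrow> ('v \<Rightarrow> complex)"
  where "weighted_shift V E lam = (\<lambda>f\<in>ell2 V. \<lambda>v.
    if v \<in> V - {tree_root V E} then of_real (lam v) * f (the (par E v)) else 0)"

text \<open>\<open>path_weight E lam k v\<close> is the product \<open>\<lambda>\<^bsub>u|v\<^esub>\<close> of the weights along the path from
  \<open>u = par\<^sup>k(v)\<close> to \<open>v\<close>. It is meaningful only if \<open>par\<^sup>k(v)\<close> exists, that is, for \<open>k \<le> |v|\<close>.\<close>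

definition path_weight :: "('v \<times> 'v) set \<Rightarrow> ('v \<Rightarrow> real) \<Rightarrow> nat \<Rightarrow> 'v \<Rightarrow> real"
  where "path_weight E lam k v = (\<Prod>n<k. lam (the (par_pow E n v)))"

definition Gamma_op ::
    "'v set \<Rightarrow> ('v \<times> 'v) set \<Rightarrow> ('v \<Rightarrow> real) \<Rightarrow> (nat \<Rightarrow> complex) \<Rightarrow> ('v \<Rightarrow> complex) \<Rightarrow> ('v \<Rightarrow> complex)"
  where "Gamma_op V E lam \<phi> f = (\<lambda>v.
    if v \<in> V
    then \<Sum>k\<le>depth V E v. of_real (path_weight E lam k v) * \<phi> k * f (the (par_pow E k v))
    else 0)"

definition mult_dom ::
    "'v set \<Rightarrow> ('v \<times> 'v) set \<Rightarrow> ('v \<Rightarrow> real) \<Rightarrow> (nat \<Rightarrow> complex) \<Rightarrow> ('v \<Rightarrow> complex) set"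
  where "mult_dom V E lam \<phi> = {f \<in> ell2 V. Gamma_op V E lam \<phi> f \<in> ell2 V}"

definition mult_op ::
    "'v set \<Rightarrow> ('v \<times> 'v) set \<Rightarrow> ('v \<Rightarrow> real) \<Rightarrow> (nat \<Rightarrow> complex) \<Rightarrow> ('v \<Rightarrow> complex) \<Rightarrow> ('v \<Rightarrow> complex)"
  where "mult_op V E lam \<phi> = restrict (Gamma_op V E lam \<phi>) (mult_dom V E lam \<phi>)"

definition multipliers :: "'v set \<Rightarrow> ('v \<times> 'v) set \<Rightarrow> ('v \<Rightarrow> real) \<Rightarrow> (nat \<Rightarrow> complex) set"
  where "multipliers V E lam = {\<phi>. mult_dom V E lam \<phi> = ell2 V}"

definition mult_algebra ::
    "'v set \<Rightarrow> ('v \<times> 'v) set \<Rightarrow> ('v \<Rightarrow> real) \<Rightarrow> (('v \<Rightarrow> complex) \<Rightarrow> ('v \<Rightarrow> complex)) set"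
  where "mult_algebra V E lam = mult_op V E lam ` multipliers V E lam"

end

theory Submission
  imports Defs
begin

text \<open>Every polynomial in \<open>S\<close> is the operator \<open>\<Gamma>\<close> of its coefficient sequence, and an operator is of
  this form iff certain equations between finitely many of its matrix coordinates hold; such
  equations are stable under weak limits, which gives one inclusion. Conversely, let \<open>\<phi>\<close> be a
  multiplier. Each coordinate of \<open>\<Gamma> f\<close> depends on finitely many coordinates of \<open>f\<close>, so a gliding hump
  argument shows that \<open>M\<^sub>\<phi>\<close> is bounded, by \<open>C\<close> say. The Fejer means of \<open>\<phi>\<close> give polynomials in \<open>S\<close>.
  The \<open>n\<close>-th mean is \<open>1 / (n + 1)\<close> times the sum of the compressions of \<open>M\<^sub>\<phi>\<close> to all windows of
  \<open>n + 1\<close> consecutive levels of the tree, and every vertex lies in \<open>n + 1\<close> windows, so by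
  Cauchy-Schwarz it is bounded by \<open>C\<close> as well. On unit vectors the means converge by dominated
  convergence, hence they converge strongly to \<open>M\<^sub>\<phi>\<close>.\<close>

section \<open>Square-summable functions\<close>

lemma ell2_norm_nonneg [simp]: "0 \<le> ell2_norm V f"
  unfolding ell2_norm_def by (simp add: infsum_nonneg)

lemma ell2_norm_power2: "(ell2_norm V f)\<^sup>2 = (\<Sum>\<^sub>\<infinity>v\<in>V. (cmod (f v))\<^sup>2)"
  unfolding ell2_norm_def by (simp add: infsum_nonneg)

lemma ell2_outside: "f \<in> ell2 V \<Longrightarrow> v \<notin> V \<Longrightarrow> f v = 0"
  by (simp add: ell2_def)

text \<open>A sum of nonnegative terms is the supremum of its finite partial sums, so a bound on all
  finite \<open>L2_set\<close> values gives membership and the norm bound together. The inequalities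
  for \<open>ell2_norm\<close> below reduce in this way to Minkowski for finite sums.\<close>

lemma ell2_bounded:
  assumes "\<And>v. v \<notin> V \<Longrightarrow> f v = 0"
    and bnd: "\<And>F. finite F \<Longrightarrow> F \<subseteq> V \<Longrightarrow> L2_set (\<lambda>v. cmod (f v)) F \<le> c"
  shows "f \<in> ell2 V" "ell2_norm V f \<le> c"
proof -
  have c: "0 \<le> c"
    using bnd[of "{}"] by simp
  have sq: "(\<Sum>v\<in>F. (cmod (f v))\<^sup>2) \<le> c\<^sup>2" if "finite F" "F \<subseteq> V" for F
    using bnd[OF that] by (simp add: L2_set_def real_sqrt_le_iff' sum_nonneg sqrt_le_D)
  have s: "(\<lambda>v. (cmod (f v))\<^sup>2) summable_on V"
    by (rule nonneg_bdd_above_summable_on) (auto intro!: bdd_aboveI[where M = "c\<^sup>2"] sq)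
  then show "f \<in> ell2 V"
    using assms(1) by (simp add: ell2_def)
  have "(\<Sum>\<^sub>\<infinity>v\<in>V. (cmod (f v))\<^sup>2) \<le> c\<^sup>2"
    by (rule infsum_le_finite_sums[OF s sq])
  then show "ell2_norm V f \<le> c"
    unfolding ell2_norm_def using c by (rule real_le_lsqrt[rotated -1]) 
qed

lemma L2_set_le_ell2_norm:
  assumes "f \<in> ell2 V" "finite F" "F \<subseteq> V"
  shows "L2_set (\<lambda>v. cmod (f v)) F \<le> ell2_norm V f"
  unfolding L2_set_def ell2_norm_def
  using assms by (intro real_sqrt_le_mono finite_sum_le_infsum) (auto simp: ell2_def)

lemma cmod_le_ell2_norm: "f \<in> ell2 V \<Longrightarrow> cmod (f v) \<le> ell2_norm V f"
  using L2_set_le_ell2_norm[of f V "{v}"] by (cases "v \<in> V") (auto simp: ell2_outside)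

lemma ell2_norm_mono:
  assumes g: "g \<in> ell2 V" and f: "\<And>v. v \<notin> V \<Longrightarrow> f v = 0"
    and le: "\<And>v. v \<in> V \<Longrightarrow> cmod (f v) \<le> c * cmod (g v)" and c: "0 \<le> c"
  shows "f \<in> ell2 V" "ell2_norm V f \<le> c * ell2_norm V g"
proof -
  have "L2_set (\<lambda>v. cmod (f v)) F \<le> c * ell2_norm V g" if F: "finite F" "F \<subseteq> V" for F
  proof -
    have "L2_set (\<lambda>v. cmod (f v)) F \<le> L2_set (\<lambda>v. c * cmod (g v)) F"
      using F le by (intro L2_set_mono) auto
    also have "\<dots> = c * L2_set (\<lambda>v. cmod (g v)) F"
      using c by (simp add: L2_set_right_distrib)
    also have "\<dots> \<le> c * ell2_norm V g"
      using L2_set_le_ell2_norm[OF g F] c by (rule mult_left_mono)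
    finally show ?thesis .
  qed
  with f show "f \<in> ell2 V" "ell2_norm V f \<le> c * ell2_norm V g"
    using ell2_bounded[of V f "c * ell2_norm V g"] by blast+
qed

lemma ell2_add:
  assumes f: "f \<in> ell2 V" and g: "g \<in> ell2 V"
  shows "(\<lambda>v. f v + g v) \<in> ell2 V"
    and "ell2_norm V (\<lambda>v. f v + g v) \<le> ell2_norm V f + ell2_norm V g"
proof -
  have "L2_set (\<lambda>v. cmod (f v + g v)) F \<le> ell2_norm V f + ell2_norm V g"
    if F: "finite F" "F \<subseteq> V" for F
  proof -
    have "L2_set (\<lambda>v. cmod (f v + g v)) F \<le> L2_set (\<lambda>v. cmod (f v) + cmod (g v)) F"
      by (intro L2_set_mono) (auto intro: norm_triangle_ineq)
    also have "\<dots> \<le> L2_set (\<lambda>v. cmod (f v)) F + L2_set (\<lambda>v. cmod (g v)) F"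
      by (rule L2_set_triangle_ineq)
    also have "\<dots> \<le> ell2_norm V f + ell2_norm V g"
      using F f g by (intro add_mono L2_set_le_ell2_norm)
    finally show ?thesis .
  qed
  moreover have "f v + g v = 0" if "v \<notin> V" for v
    using that f g by (simp add: ell2_outside)
  ultimately show "(\<lambda>v. f v + g v) \<in> ell2 V"
    "ell2_norm V (\<lambda>v. f v + g v) \<le> ell2_norm V f + ell2_norm V g"
    using ell2_bounded[of V "\<lambda>v. f v + g v" "ell2_norm V f + ell2_norm V g"] by blast+
qed

lemma ell2_scale:
  assumes "f \<in> ell2 V"
  shows "(\<lambda>v. c * f v) \<in> ell2 V" and "ell2_norm V (\<lambda>v. c * f v) \<le> cmod c * ell2_norm V f"
  using ell2_norm_mono[OF assms, of "\<lambda>v. c * f v" "cmod c"] assms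
  by (simp_all add: norm_mult ell2_outside)

lemma ell2_diff:
  assumes f: "f \<in> ell2 V" and g: "g \<in> ell2 V"
  shows "(\<lambda>v. f v - g v) \<in> ell2 V"
    and "ell2_norm V (\<lambda>v. f v - g v) \<le> ell2_norm V f + ell2_norm V g"
  using ell2_add[OF f ell2_scale(1)[OF g, of "-1"]] ell2_scale(2)[OF g, of "-1"] by simp_all

lemma ell2_sum:
  assumes "finite I" "\<And>i. i \<in> I \<Longrightarrow> h i \<in> ell2 V"
  shows "(\<lambda>v. \<Sum>i\<in>I. h i v) \<in> ell2 V
    \<and> ell2_norm V (\<lambda>v. \<Sum>i\<in>I. h i v) \<le> (\<Sum>i\<in>I. ell2_norm V (h i))"
  using assms
proof (induction I rule: finite_induct)
  case empty
  then show ?case by (simp add: zero_in_ell2 ell2_norm_def)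
next
  case (insert i I)
  then have 1: "h i \<in> ell2 V" and 2: "(\<lambda>v. \<Sum>i\<in>I. h i v) \<in> ell2 V"
    and 3: "ell2_norm V (\<lambda>v. \<Sum>i\<in>I. h i v) \<le> (\<Sum>i\<in>I. ell2_norm V (h i))" by auto
  show ?case
    using ell2_add[OF 1 2] 3 insert.hyps by simp
qed

lemma ell2_norm_eq_0_iff: "f \<in> ell2 V \<Longrightarrow> ell2_norm V f = 0 \<longleftrightarrow> f = (\<lambda>v. 0)"
  using cmod_le_ell2_norm[of f V] by (auto simp: ell2_norm_def)

section \<open>Truncations and unit vectors\<close>

definition cutoff :: "'v set \<Rightarrow> ('v \<Rightarrow> complex) \<Rightarrow> 'v \<Rightarrow> complex"
  where "cutoff G f = (\<lambda>v. if v \<in> G then f v else 0)"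

lemma cutoff_ell2:
  assumes "f \<in> ell2 V"
  shows "cutoff G f \<in> ell2 V" and "ell2_norm V (cutoff G f) \<le> ell2_norm V f"
  using ell2_norm_mono[OF assms, of "cutoff G f" 1] assms
  by (simp_all add: cutoff_def ell2_outside)

lemma finite_support_ell2:
  assumes "finite G" "G \<subseteq> V"
  shows "cutoff G f \<in> ell2 V"
proof (rule ell2_bounded(1))
  show "cutoff G f v = 0" if "v \<notin> V" for v
    using that assms(2) by (auto simp: cutoff_def)
  fix F assume F: "finite F" "F \<subseteq> V"
  have "L2_set (\<lambda>v. cmod (cutoff G f v)) F \<le> (\<Sum>v\<in>F. cmod (cutoff G f v))"
    by (rule L2_set_le_sum) auto
  also have "\<dots> = (\<Sum>v\<in>F \<inter> G. cmod (f v))"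
    using F(1) by (auto simp: cutoff_def sum.inter_restrict if_distrib intro!: sum.cong)
  also have "\<dots> \<le> (\<Sum>v\<in>G. cmod (f v))"
    using assms(1) by (intro sum_mono2) auto
  finally show "L2_set (\<lambda>v. cmod (cutoff G f v)) F \<le> (\<Sum>v\<in>G. cmod (f v))" .
qed

definition unit_vec :: "'v \<Rightarrow> 'v \<Rightarrow> complex"
  where "unit_vec u = (\<lambda>v. if v = u then 1 else 0)"

lemma unit_vec_ell2: "u \<in> V \<Longrightarrow> unit_vec u \<in> ell2 V"
  using finite_support_ell2[of "{u}" V "\<lambda>_. 1"] by (simp add: cutoff_def unit_vec_def)

lemma cutoff_eq_sum_unit_vec:
  "finite G \<Longrightarrow> cutoff G f = (\<lambda>v. \<Sum>u\<in>G. f u * unit_vec u v)"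
  by (auto simp: cutoff_def unit_vec_def if_distrib sum.delta' cong: if_cong)

text \<open>Pairing with a unit vector isolates a coordinate; this is what makes
  \<open>T f v\<close> weakly continuous in \<open>T\<close>.\<close>

lemma ell2_inner_unit_vec: "v \<in> V \<Longrightarrow> ell2_inner V f (unit_vec v) = f v"
  unfolding ell2_inner_def unit_vec_def
  by (subst infsum_cong_neutral[where T = "{v}" and g = f]) auto

section \<open>The inner product and Cauchy-Schwarz\<close>

lemma ell2_inner_abs_summable:
  assumes f: "f \<in> ell2 V" and g: "g \<in> ell2 V"
  shows "(\<lambda>v. cmod (f v * cnj (g v))) summable_on V"
    and "(\<Sum>\<^sub>\<infinity>v\<in>V. cmod (f v * cnj (g v))) \<le> ell2_norm V f * ell2_norm V g"
proof -
  have fin: "(\<Sum>v\<in>F. cmod (f v * cnj (g v))) \<le> ell2_norm V f * ell2_norm V g"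
    if F: "finite F" "F \<subseteq> V" for F
  proof -
    have "(\<Sum>v\<in>F. cmod (f v * cnj (g v))) = (\<Sum>v\<in>F. \<bar>cmod (f v)\<bar> * \<bar>cmod (g v)\<bar>)"
      by (simp add: norm_mult)
    also have "\<dots> \<le> L2_set (\<lambda>v. cmod (f v)) F * L2_set (\<lambda>v. cmod (g v)) F"
      by (rule L2_set_mult_ineq)
    also have "\<dots> \<le> ell2_norm V f * ell2_norm V g"
      using F f g by (intro mult_mono L2_set_le_ell2_norm) auto
    finally show ?thesis .
  qed
  show s: "(\<lambda>v. cmod (f v * cnj (g v))) summable_on V"
    by (rule nonneg_bdd_above_summable_on)
      (auto intro!: bdd_aboveI[where M = "ell2_norm V f * ell2_norm V g"] fin simp del: norm_mult)
  show "(\<Sum>\<^sub>\<infinity>v\<in>V. cmod (f v * cnj (g v))) \<le> ell2_norm V f * ell2_norm V g"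
    by (rule infsum_le_finite_sums[OF s fin])
qed

lemma ell2_inner_bound:
  assumes "f \<in> ell2 V" "g \<in> ell2 V"
  shows "cmod (ell2_inner V f g) \<le> ell2_norm V f * ell2_norm V g"
  unfolding ell2_inner_def
  using norm_infsum_bound[OF ell2_inner_abs_summable(1)[OF assms]] ell2_inner_abs_summable(2)[OF assms]
  by linarith

lemma ell2_inner_add:
  assumes "f \<in> ell2 V" "g \<in> ell2 V" "h \<in> ell2 V"
  shows "ell2_inner V (\<lambda>v. f v + g v) h = ell2_inner V f h + ell2_inner V g h"
  unfolding ell2_inner_def distrib_right
  using assms by (intro infsum_add abs_summable_summable[OF ell2_inner_abs_summable(1)])

section \<open>Tails and dominated convergence\<close>

lemma ell2_norm_cutoff_diff_small:
  assumes f: "f \<in> ell2 V" and e: "e > 0"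
  obtains G where "finite G" "G \<subseteq> V" "ell2_norm V (\<lambda>v. f v - cutoff G f v) \<le> e"
proof -
  have s: "(\<lambda>v. (cmod (f v))\<^sup>2) summable_on V"
    using f by (simp add: ell2_def)
  obtain G where G: "finite G" "G \<subseteq> V"
    and d: "dist (\<Sum>v\<in>G. (cmod (f v))\<^sup>2) (\<Sum>\<^sub>\<infinity>v\<in>V. (cmod (f v))\<^sup>2) \<le> e\<^sup>2"
    using infsum_finite_approximation[OF s, of "e\<^sup>2"] e by auto
  have "L2_set (\<lambda>v. cmod (f v - cutoff G f v)) F \<le> e" if F: "finite F" "F \<subseteq> V" for F
  proof -
    have "(\<Sum>v\<in>F. (cmod (f v - cutoff G f v))\<^sup>2) = (\<Sum>v\<in>F - G. (cmod (f v))\<^sup>2)"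
      using F(1) by (auto simp: cutoff_def intro!: sum.mono_neutral_cong_right)
    \<comment> \<open>Adding \<open>G\<close> to \<open>F\<close> writes the mass off
      \<open>G\<close> as a difference: the first sum is at most the total, which the sum over
      \<open>G\<close> approximates.\<close>
    also have "\<dots> = (\<Sum>v\<in>F \<union> G. (cmod (f v))\<^sup>2) - (\<Sum>v\<in>G. (cmod (f v))\<^sup>2)"
      using F(1) G(1) sum.union_disjoint[of "F - G" G "\<lambda>v. (cmod (f v))\<^sup>2"]
      by (simp add: Diff_disjoint Int_commute)
    also have "(\<Sum>v\<in>F \<union> G. (cmod (f v))\<^sup>2) \<le> (\<Sum>\<^sub>\<infinity>v\<in>V. (cmod (f v))\<^sup>2)"
      using F G by (intro finite_sum_le_infsum[OF s]) auto
    also have "(\<Sum>\<^sub>\<infinity>v\<in>V. (cmod (f v))\<^sup>2) - (\<Sum>v\<in>G. (cmod (f v))\<^sup>2) \<le> e\<^sup>2"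
      using d by (simp add: dist_real_def)
    finally show ?thesis
      using e by (auto simp: L2_set_def intro!: real_le_lsqrt sum_nonneg)
  qed
  moreover have "f v - cutoff G f v = 0" if "v \<notin> V" for v
    using that f by (simp add: ell2_outside cutoff_def)
  ultimately have "ell2_norm V (\<lambda>v. f v - cutoff G f v) \<le> e"
    by (intro ell2_bounded(2)[of V "\<lambda>v. f v - cutoff G f v" e]) auto
  with G that show ?thesis by blast
qed

text \<open>Off a suitable finite set \<open>G\<close> the bound \<open>1\<close> on the factors
  leaves at most the small tail of \<open>h\<close>; on \<open>G\<close> only finitely many null
  sequences are added up.\<close>

lemma ell2_dominated_convergence:
  fixes c :: "nat \<Rightarrow> 'v \<Rightarrow> complex"
  assumes h: "h \<in> ell2 V" and c1: "\<And>n v. v \<in> V \<Longrightarrow> cmod (c n v) \<le> 1"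
    and c0: "\<And>v. v \<in> V \<Longrightarrow> (\<lambda>n. c n v) \<longlonglongrightarrow> 0"
  shows "(\<lambda>n. ell2_norm V (\<lambda>v. c n v * h v)) \<longlonglongrightarrow> 0"
proof (rule LIMSEQ_I)
  fix e :: real assume e: "e > 0"
  obtain G where G: "finite G" "G \<subseteq> V" and tail: "ell2_norm V (\<lambda>v. h v - cutoff G h v) \<le> e / 2"
    using ell2_norm_cutoff_diff_small[OF h, of "e / 2"] e by auto
  have "(\<lambda>n. \<Sum>v\<in>G. cmod (c n v * h v)) \<longlonglongrightarrow> (\<Sum>v\<in>G. cmod (0 * h v))"
    using G(2) by (intro tendsto_intros c0) auto
  then have "(\<lambda>n. \<Sum>v\<in>G. cmod (c n v * h v)) \<longlonglongrightarrow> 0" by simp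
  from order_tendstoD(2)[OF this, of "e / 2"] e
  obtain N where N: "\<And>n. n \<ge> N \<Longrightarrow> (\<Sum>v\<in>G. cmod (c n v * h v)) < e / 2"
    by (auto simp: eventually_sequentially)
  have "ell2_norm V (\<lambda>v. c n v * h v) < e" if n: "n \<ge> N" for n
  proof -
    have t: "(\<lambda>v. h v - cutoff G h v) \<in> ell2 V"
      by (intro ell2_diff h cutoff_ell2)
    have sm: "(\<lambda>v. \<Sum>u\<in>G. c n u * h u * unit_vec u v) \<in> ell2 V
      \<and> ell2_norm V (\<lambda>v. \<Sum>u\<in>G. c n u * h u * unit_vec u v)
        \<le> (\<Sum>u\<in>G. ell2_norm V (\<lambda>v. c n u * h u * unit_vec u v))"
      using G by (intro ell2_sum ell2_scale unit_vec_ell2) auto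
    have "(\<lambda>v. c n v * h v)
      = (\<lambda>v. (\<Sum>u\<in>G. c n u * h u * unit_vec u v) + c n v * (h v - cutoff G h v))"
      using cutoff_eq_sum_unit_vec[OF G(1), of "\<lambda>v. c n v * h v", symmetric]
      by (simp add: fun_eq_iff) (simp add: cutoff_def)
    moreover
    have "(\<lambda>v. c n v * (h v - cutoff G h v)) \<in> ell2 V"
      "ell2_norm V (\<lambda>v. c n v * (h v - cutoff G h v)) \<le> 1 * ell2_norm V (\<lambda>v. h v - cutoff G h v)"
      using ell2_norm_mono[OF t, of "\<lambda>v. c n v * (h v - cutoff G h v)" 1] c1[of _ n] ell2_outside[OF t]
      by (simp_all add: norm_mult mult_left_le_one_le)
    moreover have "(\<Sum>u\<in>G. ell2_norm V (\<lambda>v. c n u * h u * unit_vec u v)) \<le> (\<Sum>u\<in>G. cmod (c n u * h u))"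
    proof (rule sum_mono)
      fix u assume "u \<in> G"
      then have u: "u \<in> V" using G by auto
      have "ell2_norm V (unit_vec u) \<le> 1"
        unfolding ell2_norm_def unit_vec_def
        by (subst infsum_cong_neutral[where T = "{u}" and g = "\<lambda>_. 1"]) (use u in auto)
      then have "cmod (c n u * h u) * ell2_norm V (unit_vec u) \<le> cmod (c n u * h u) * 1"
        by (rule mult_left_mono) simp
      then show "ell2_norm V (\<lambda>v. c n u * h u * unit_vec u v) \<le> cmod (c n u * h u)"
        using ell2_scale(2)[OF unit_vec_ell2[OF u], of "c n u * h u"] by linarith
    qed
    ultimately have "ell2_norm V (\<lambda>v. c n v * h v)
        \<le> (\<Sum>u\<in>G. cmod (c n u * h u)) + ell2_norm V (\<lambda>v. h v - cutoff G h v)"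
      using ell2_add(2)[of "\<lambda>v. \<Sum>u\<in>G. c n u * h u * unit_vec u v" V "\<lambda>v. c n v * (h v - cutoff G h v)"] sm
      by auto
    with N[OF n] tail show ?thesis by linarith
  qed
  then show "\<exists>N. \<forall>n\<ge>N. norm (ell2_norm V (\<lambda>v. c n v * h v) - 0) < e" by auto
qed

section \<open>Boundedness of row-finite operators\<close>

text \<open>This replaces the closed graph theorem: boundedness is derived from finite rows and from
  \<open>T\<close> mapping \<open>ell2 V\<close> into itself. Linearity is required on all
  functions, as \<open>Gamma_op\<close> has it, which avoids membership conditions.\<close>

locale row_finite_operator =
  fixes V :: "'v set" and T :: "('v \<Rightarrow> complex) \<Rightarrow> 'v \<Rightarrow> complex" and A :: "'v \<Rightarrow> 'v set"
  assumes ell2_closed: "\<And>f. f \<in> ell2 V \<Longrightarrow> T f \<in> ell2 V"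
    and additive: "\<And>f g. T (\<lambda>v. f v + g v) = (\<lambda>v. T f v + T g v)"
    and homogeneous: "\<And>c f. T (\<lambda>v. c * f v) = (\<lambda>v. c * T f v)"
    and finite_row: "\<And>v. v \<in> V \<Longrightarrow> finite (A v)"
    and row_subset: "\<And>v. v \<in> V \<Longrightarrow> A v \<subseteq> V"
    and row_local: "\<And>f g v. v \<in> V \<Longrightarrow> (\<And>u. u \<in> A v \<Longrightarrow> f u = g u) \<Longrightarrow> T f v = T g v"
begin

lemma zero: "T (\<lambda>v. 0) = (\<lambda>v. 0)"
  using homogeneous[of 0 "\<lambda>v. 0"] by simp

lemma sum: "finite I \<Longrightarrow> T (\<lambda>v. \<Sum>i\<in>I. h i v) = (\<lambda>v. \<Sum>i\<in>I. T (h i) v)"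
  by (induction I rule: finite_induct) (simp_all add: zero additive)

text \<open>The image is a combination of the finitely many vectors \<open>T (unit_vec u)\<close>,
  whose coefficients \<open>f u\<close> are at most the norm of \<open>f\<close>.\<close>

lemma bounded_on_finite_support:
  assumes G: "finite G" "G \<subseteq> V"
  obtains C where "C \<ge> 0" "\<And>f. f \<in> ell2 V \<Longrightarrow> ell2_norm V (T (cutoff G f)) \<le> C * ell2_norm V f"
proof
  show "0 \<le> (\<Sum>u\<in>G. ell2_norm V (T (unit_vec u)))"
    by (simp add: sum_nonneg)
  fix f assume f: "f \<in> ell2 V"
  have u: "T (unit_vec u) \<in> ell2 V" if "u \<in> G" for u
    using that G(2) by (auto intro: ell2_closed unit_vec_ell2)
  have "T (cutoff G f) = (\<lambda>v. \<Sum>u\<in>G. f u * T (unit_vec u) v)"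
    by (simp add: cutoff_eq_sum_unit_vec[OF G(1)] sum[OF G(1)] homogeneous)
  then have "ell2_norm V (T (cutoff G f)) \<le> (\<Sum>u\<in>G. ell2_norm V (\<lambda>v. f u * T (unit_vec u) v))"
    using ell2_sum[OF G(1), of "\<lambda>u v. f u * T (unit_vec u) v"] u by (simp add: ell2_scale)
  also have "\<dots> \<le> (\<Sum>u\<in>G. ell2_norm V f * ell2_norm V (T (unit_vec u)))"
    using u ell2_scale(2) cmod_le_ell2_norm[OF f]
    by (intro sum_mono order_trans[OF ell2_scale(2)] mult_right_mono) auto
  finally show "ell2_norm V (T (cutoff G f)) \<le> (\<Sum>u\<in>G. ell2_norm V (T (unit_vec u))) * ell2_norm V f"
    by (simp add: sum_distrib_left mult.commute)
qed

text \<open>Since \<open>T\<close> is bounded on functions supported in \<open>G\<close>, its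
  unboundedness comes from functions vanishing on \<open>G\<close>. A small multiple of such a
  function is added to \<open>g\<close>. The set \<open>G'\<close> contains every coordinate read by
  the rows in \<open>F\<close>, so later changes off \<open>G'\<close> cannot destroy the large
  value reached there.\<close>

lemma gliding_hump_step:
  fixes b :: real
  assumes unbounded: "\<And>C. \<exists>f\<in>ell2 V. ell2_norm V (T f) > C * ell2_norm V f"
    and G: "finite G" "G \<subseteq> V" and g: "g \<in> ell2 V" "\<And>v. v \<notin> G \<Longrightarrow> g v = 0" and d: "d > 0"
  obtains G' g' F where "finite G'" "G \<subseteq> G'" "G' \<subseteq> V" "\<And>v. v \<notin> G' \<Longrightarrow> g' v = 0"
    "\<And>v. v \<in> G \<Longrightarrow> g' v = g v" "g' \<in> ell2 V" "ell2_norm V (\<lambda>v. g' v - g v) \<le> d"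
    "finite F" "F \<subseteq> V" "(\<Union>v\<in>F. A v) \<subseteq> G'" "L2_set (\<lambda>v. cmod (T g' v)) F > b"
proof -
  obtain C where C: "C \<ge> 0" "\<And>f. f \<in> ell2 V \<Longrightarrow> ell2_norm V (T (cutoff G f)) \<le> C * ell2_norm V f"
    using bounded_on_finite_support[OF G] by blast
  \<comment> \<open>Large enough to exceed \<open>b\<close> even after the contribution of
    \<open>T g\<close> is subtracted.\<close>
  define M where "M = \<bar>b\<bar> + ell2_norm V (T g)"
  have M: "M \<ge> 0" by (simp add: M_def)
  \<comment> \<open>The summand \<open>C\<close> pays for the part of \<open>f\<close> on
    \<open>G\<close>; \<open>M / d\<close> becomes \<open>M\<close> once \<open>f\<close> is scaled
    to norm \<open>d\<close>.\<close>
  obtain f where f: "f \<in> ell2 V" and big: "ell2_norm V (T f) > (C + M / d) * ell2_norm V f"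
    using unbounded by blast
  have pos: "ell2_norm V f > 0"
  proof (rule ccontr)
    assume "\<not> ell2_norm V f > 0"
    then have "f = (\<lambda>v. 0)"
      using ell2_norm_eq_0_iff[OF f] ell2_norm_nonneg[of V f] by linarith
    then show False using big by (simp add: zero ell2_norm_def)
  qed
  define s where "s = d / ell2_norm V f"
  have s: "s > 0" using d pos by (simp add: s_def)
  define h where "h = (\<lambda>v. of_real s * cutoff (- G) f v)"
  have f1: "cutoff (- G) f \<in> ell2 V" "ell2_norm V (cutoff (- G) f) \<le> ell2_norm V f"
    using cutoff_ell2[OF f] by auto
  have h: "h \<in> ell2 V" unfolding h_def by (intro ell2_scale f1)
  have h_norm: "ell2_norm V h \<le> d"
  proof -
    have "ell2_norm V h \<le> s * ell2_norm V (cutoff (- G) f)"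
      using ell2_scale(2)[OF f1(1), of "of_real s"] s by (simp add: h_def)
    also have "\<dots> \<le> s * ell2_norm V f" using f1(2) s by simp
    finally show ?thesis using pos by (simp add: s_def)
  qed
  have Th: "ell2_norm V (T h) > M"
  proof -
    have "(\<lambda>v. cutoff G f v + cutoff (- G) f v) = f"
      by (auto simp: cutoff_def)
    then have "T f = (\<lambda>v. T (cutoff G f) v + T (cutoff (- G) f) v)"
      using additive[of "cutoff G f" "cutoff (- G) f"] by simp
    then have "ell2_norm V (T f) \<le> ell2_norm V (T (cutoff G f)) + ell2_norm V (T (cutoff (- G) f))"
      using ell2_add(2)[OF ell2_closed[OF cutoff_ell2(1)[OF f]] ell2_closed[OF f1(1)]] by simp
    moreover have "T (cutoff (- G) f) = (\<lambda>v. of_real (1 / s) * T h v)"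
      using s by (simp add: h_def homogeneous)
    then have "ell2_norm V (T (cutoff (- G) f)) \<le> (1 / s) * ell2_norm V (T h)"
      using ell2_scale(2)[OF ell2_closed[OF h], of "of_real (1 / s)"] s by (simp del: of_real_divide)
    ultimately have "(M / d) * ell2_norm V f < (1 / s) * ell2_norm V (T h)"
      using big C(2)[OF f] by (simp add: distrib_right)
    then show ?thesis
      using d pos by (simp add: s_def field_simps)
  qed
  obtain F where F: "finite F" "F \<subseteq> V" and Fbig: "L2_set (\<lambda>v. cmod (T h v)) F > M"
    using ell2_bounded(2)[of V "T h" M] ell2_outside[OF ell2_closed[OF h]] Th by (meson not_le)
  define G' where "G' = G \<union> (\<Union>v\<in>F. A v)"
  define g' where "g' = (\<lambda>v. g v + cutoff G' h v)"
  have G': "finite G'" "G' \<subseteq> V" "G \<subseteq> G'" "(\<Union>v\<in>F. A v) \<subseteq> G'"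
    using G F(1) subsetD[OF F(2)] finite_row row_subset unfolding G'_def by (blast | simp)+
  have c: "cutoff G' h \<in> ell2 V" "ell2_norm V (cutoff G' h) \<le> d"
    using cutoff_ell2[OF h, of G'] h_norm by auto
  show ?thesis
  proof
    show "finite G'" "G \<subseteq> G'" "G' \<subseteq> V" "finite F" "F \<subseteq> V" "(\<Union>v\<in>F. A v) \<subseteq> G'" by fact+
    show "g' v = 0" if "v \<notin> G'" for v
      using that G'(3) g(2)[of v] by (auto simp: g'_def cutoff_def)
    show "g' v = g v" if "v \<in> G" for v
      using that by (simp add: g'_def cutoff_def h_def)
    show "g' \<in> ell2 V" unfolding g'_def by (intro ell2_add g c)
    show "ell2_norm V (\<lambda>v. g' v - g v) \<le> d" using c(2) by (simp add: g'_def)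
    \<comment> \<open>The rows in \<open>F\<close> do not see the truncation of \<open>h\<close> to
      \<open>G'\<close>.\<close>
    have "T h v = T g' v + (- T g v)" if "v \<in> F" for v
    proof -
      have "T (cutoff G' h) v = T h v"
        using that F G'(4) by (intro row_local) (auto simp: cutoff_def)
      then show ?thesis by (simp add: g'_def additive)
    qed
    then have "L2_set (\<lambda>v. cmod (T h v)) F \<le> L2_set (\<lambda>v. cmod (T g' v) + cmod (T g v)) F"
      by (intro L2_set_mono) (auto intro: norm_triangle_ineq4)
    also have "\<dots> \<le> L2_set (\<lambda>v. cmod (T g' v)) F + L2_set (\<lambda>v. cmod (T g v)) F"
      by (rule L2_set_triangle_ineq)
    also have "L2_set (\<lambda>v. cmod (T g v)) F \<le> ell2_norm V (T g)"
      by (intro L2_set_le_ell2_norm ell2_closed g F)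
    finally show "L2_set (\<lambda>v. cmod (T g' v)) F > b"
      using Fbig by (simp add: M_def)
  qed
qed

text \<open>If \<open>T\<close> were unbounded, humps of norm at most \<open>(1/2) ^ n\<close> could
  be added one after another. They sum to some \<open>f\<close> in \<open>ell2 V\<close>, while the
  values frozen at stage \<open>n\<close> force the norm of \<open>T f\<close> above every
  \<open>n\<close>.\<close>

lemma bounded:
  obtains C where "C \<ge> 0" "\<And>f. f \<in> ell2 V \<Longrightarrow> ell2_norm V (T f) \<le> C * ell2_norm V f"
proof (rule ccontr)
  assume not_thesis: "\<not> thesis"
  have unbounded: "\<exists>f\<in>ell2 V. ell2_norm V (T f) > C * ell2_norm V f" for C
  proof (rule ccontr)
    assume "\<not> (\<exists>f\<in>ell2 V. ell2_norm V (T f) > C * ell2_norm V f)"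
    \<comment> \<open>The absolute value makes the constant nonnegative, as the conclusion
      demands.\<close>
    then have "ell2_norm V (T f) \<le> \<bar>C\<bar> * ell2_norm V f" if "f \<in> ell2 V" for f
      using that mult_right_mono[OF abs_ge_self[of C] ell2_norm_nonneg[of V f]] by fastforce
    with not_thesis show False
      using that[OF abs_ge_zero[of C]] by blast
  qed
  define P where "P = (\<lambda>(n::nat) (G, g). finite G \<and> G \<subseteq> V \<and> g \<in> ell2 V \<and> (\<forall>v. v \<notin> G \<longrightarrow> g v = 0))"
  define Q where "Q = (\<lambda>n (G, g) (G', g'). G \<subseteq> G' \<and> (\<forall>v\<in>G. g' v = g v)
    \<and> ell2_norm V (\<lambda>v. g' v - g v) \<le> (1/2) ^ n
    \<and> (\<exists>F. finite F \<and> F \<subseteq> V \<and> (\<Union>v\<in>F. A v) \<subseteq> G' \<and> L2_set (\<lambda>v. cmod (T g' v)) F > real n))"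
  have "\<exists>S. \<forall>n. P n (S n) \<and> Q n (S n) (S (Suc n))"
  proof (rule dependent_nat_choice)
    show "\<exists>x. P 0 x"
      by (rule exI[of _ "({}, \<lambda>v. 0)"]) (simp add: P_def zero_in_ell2)
    fix x n assume "P n x"
    then obtain G g where x: "x = (G, g)" and Pg: "finite G" "G \<subseteq> V" "g \<in> ell2 V" "\<And>v. v \<notin> G \<Longrightarrow> g v = 0"
      by (cases x) (auto simp: P_def)
    obtain G' g' F where "finite G'" "G \<subseteq> G'" "G' \<subseteq> V" "\<And>v. v \<notin> G' \<Longrightarrow> g' v = 0"
      "\<And>v. v \<in> G \<Longrightarrow> g' v = g v" "g' \<in> ell2 V" "ell2_norm V (\<lambda>v. g' v - g v) \<le> (1/2) ^ n"
      "finite F" "F \<subseteq> V" "(\<Union>v\<in>F. A v) \<subseteq> G'" "L2_set (\<lambda>v. cmod (T g' v)) F > real n"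
      by (rule gliding_hump_step[OF unbounded Pg, where d = "(1/2) ^ n" and b = "real n"]) auto
    then have "P (Suc n) (G', g') \<and> Q n x (G', g')"
      unfolding x P_def Q_def by auto
    then show "\<exists>y. P (Suc n) y \<and> Q n x y" by blast
  qed
  then obtain S where S: "\<And>n. P n (S n)" "\<And>n. Q n (S n) (S (Suc n))" by blast
  define G g where "G n = fst (S n)" and "g n = snd (S n)" for n
  have G: "finite (G n)" "G n \<subseteq> V" "g n \<in> ell2 V" "v \<notin> G n \<Longrightarrow> g n v = 0" for n v
    using S(1)[of n] by (auto simp: P_def G_def g_def split: prod.splits)
  have step: "G n \<subseteq> G (Suc n)" "v \<in> G n \<Longrightarrow> g (Suc n) v = g n v"
    "ell2_norm V (\<lambda>v. g (Suc n) v - g n v) \<le> (1/2) ^ n"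
    "\<exists>F. finite F \<and> F \<subseteq> V \<and> (\<Union>v\<in>F. A v) \<subseteq> G (Suc n) \<and> L2_set (\<lambda>v. cmod (T (g (Suc n)) v)) F > real n" for n v
    using S(2)[of n] by (auto simp: Q_def G_def g_def split: prod.splits)
  note g_Suc = step(2)
  have G_mono: "G m \<subseteq> G n" if "m \<le> n" for m n
    using that by (rule lift_Suc_mono_le[of G, OF step(1)])
  have g_eq: "g n v = g m v" if "v \<in> G m" "m \<le> n" for m n v
    using that(2)
  proof (induction n rule: dec_induct)
    case (step n)
    then have "v \<in> G n" using G_mono[of m n] that(1) by auto
    then show ?case using step.IH g_Suc by simp
  qed simp
  \<comment> \<open>The pointwise limit: once \<open>v\<close> has entered some \<open>G n\<close>,
    its value never changes again, so the first such stage determines it.\<close>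
  define f where "f v = (if \<exists>n. v \<in> G n then g (LEAST n. v \<in> G n) v else 0)" for v
  have f_eq: "f v = g n v" if "v \<in> G n" for v n
    using that g_eq[of v "LEAST n. v \<in> G n" n] LeastI[of "\<lambda>n. v \<in> G n" n] Least_le[of "\<lambda>n. v \<in> G n" n]
    by (auto simp: f_def)
  \<comment> \<open>The subtracted term makes the induction close: the first \<open>n\<close> humps
    have total norm at most \<open>2 - 2 * (1/2) ^ n\<close>.\<close>
  have g_norm: "ell2_norm V (g n) \<le> ell2_norm V (g 0) + 2 - 2 * (1/2) ^ n" for n
  proof (induction n)
    case (Suc n)
    have "ell2_norm V (g (Suc n)) \<le> ell2_norm V (g n) + ell2_norm V (\<lambda>v. g (Suc n) v - g n v)"
      using ell2_add(2)[OF G(3)[of n] ell2_diff(1)[OF G(3)[of "Suc n"] G(3)[of n]]] by simp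
    then show ?case using Suc step(3)[of n] by simp
  qed simp
  have f: "f \<in> ell2 V"
  proof (rule ell2_bounded(1))
    show "f v = 0" if "v \<notin> V" for v
      using that G(2) by (auto simp: f_def)
    fix F assume F: "finite F" "F \<subseteq> V"
    \<comment> \<open>The sets \<open>G n\<close> increase, so one stage contains all vertices of
      \<open>F\<close> that are ever reached; at the remaining ones both \<open>f\<close> and
      \<open>g n\<close> vanish.\<close>
    have "\<exists>n. F \<inter> (\<Union>n. G n) \<subseteq> G n"
      using F(1)
    proof (induction F)
      case (insert x F)
      then obtain n where n: "F \<inter> (\<Union>n. G n) \<subseteq> G n" by auto
      show ?case
      proof (cases "\<exists>m. x \<in> G m")
        case True
        then obtain m where "x \<in> G m" by blast
        then have "insert x F \<inter> (\<Union>n. G n) \<subseteq> G (max m n)"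
          using n G_mono[of m "max m n"] G_mono[of n "max m n"] by auto
        then show ?thesis by blast
      qed (use n in auto)
    qed simp
    then obtain n where n: "F \<inter> (\<Union>n. G n) \<subseteq> G n" ..
    have "f v = g n v" if "v \<in> F" for v
    proof (cases "v \<in> G n")
      case False
      then have "v \<notin> (\<Union>n. G n)" using n that by blast
      then show ?thesis using G(4)[OF False] by (auto simp: f_def)
    qed (rule f_eq)
    then have "L2_set (\<lambda>v. cmod (f v)) F = L2_set (\<lambda>v. cmod (g n v)) F"
      by (intro L2_set_cong) auto
    also have "\<dots> \<le> ell2_norm V (g n)" by (intro L2_set_le_ell2_norm G F)
    also have "\<dots> \<le> ell2_norm V (g 0) + 2"
      using g_norm[of n] by (smt (verit) zero_le_power zero_le_divide_1_iff)
    finally show "L2_set (\<lambda>v. cmod (f v)) F \<le> ell2_norm V (g 0) + 2" .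
  qed
  have "ell2_norm V (T f) > real n" for n
  proof -
    obtain F where F: "finite F" "F \<subseteq> V" "(\<Union>v\<in>F. A v) \<subseteq> G (Suc n)"
      "L2_set (\<lambda>v. cmod (T (g (Suc n)) v)) F > real n"
      using step(4)[of n] by auto
    have "T f v = T (g (Suc n)) v" if "v \<in> F" for v
      using that F(2,3) by (intro row_local f_eq[of _ "Suc n"]) auto
    then have "L2_set (\<lambda>v. cmod (T (g (Suc n)) v)) F = L2_set (\<lambda>v. cmod (T f v)) F"
      by (intro L2_set_cong) auto
    also have "\<dots> \<le> ell2_norm V (T f)"
      by (intro L2_set_le_ell2_norm ell2_closed f F(1,2))
    finally show ?thesis using F(4) by linarith
  qed
  then show False
    using reals_Archimedean2[of "ell2_norm V (T f)"] less_asym by blast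
qed

end

section \<open>Multiplication operators on a weighted rooted tree\<close>

lemma par_pow_Suc_shift: "par E v = Some u \<Longrightarrow> par_pow E (Suc m) v = par_pow E m u"
  by (induction m) (simp_all add: map_comp_def)

locale weighted_rooted_tree = directed_tree V E for V :: "'v set" and E +
  fixes lam :: "'v \<Rightarrow> real"
  assumes has_root: "rooted V E"
begin

abbreviation root :: 'v where "root \<equiv> tree_root V E"
abbreviation dep :: "'v \<Rightarrow> nat" where "dep \<equiv> depth V E"
abbreviation anc :: "nat \<Rightarrow> 'v \<Rightarrow> 'v" where "anc k v \<equiv> the (par_pow E k v)"
abbreviation pw :: "nat \<Rightarrow> 'v \<Rightarrow> real" where "pw \<equiv> path_weight E lam"
abbreviation Gam :: "(nat \<Rightarrow> complex) \<Rightarrow> ('v \<Rightarrow> complex) \<Rightarrow> 'v \<Rightarrow> complex" where "Gam \<equiv> Gamma_op V E lam"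
abbreviation S :: "('v \<Rightarrow> complex) \<Rightarrow> 'v \<Rightarrow> complex" where "S \<equiv> weighted_shift V E lam"

section \<open>Depth, ancestors and path weights\<close>

lemma root_in_V: "root \<in> V" and par_root: "par E root = None"
  using is_root_tree_root[OF has_root] by (auto simp: is_root_def)

lemma par_pow_depth: "v \<in> V \<Longrightarrow> par_pow E (dep v) v = Some root"
  unfolding depth_def by (rule theI'[OF depth_unique[OF has_root]])

lemma depth_eqI: "v \<in> V \<Longrightarrow> par_pow E k v = Some root \<Longrightarrow> dep v = k"
  using par_pow_root_unique[OF par_pow_depth] par_root by blast

lemma depth_root: "dep root = 0"
  by (rule depth_eqI) (simp_all add: root_in_V)

lemma depth_child:
  assumes "par E v = Some u"
  shows "u \<in> V" "v \<in> V" "v \<noteq> root" "dep v = Suc (dep u)"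
proof -
  show uv: "u \<in> V" "v \<in> V"
    using assms edges by (auto simp: par_eq_Some_iff)
  show "v \<noteq> root" using assms par_root by auto
  show "dep v = Suc (dep u)"
    using depth_eqI[OF uv(2)] par_pow_Suc_shift[OF assms] par_pow_depth[OF uv(1)] by simp
qed

lemma parent_exists:
  assumes "v \<in> V" "v \<noteq> root"
  obtains u where "par E v = Some u"
proof -
  have "par E v \<noteq> None"
    using assms is_root_unique[OF _ is_root_tree_root[OF has_root], of v] by (auto simp: is_root_def)
  with that show ?thesis by blast
qed

lemma ancestor:
  assumes "v \<in> V" "k \<le> dep v"
  shows "anc k v \<in> V" "dep (anc k v) = dep v - k"
proof -
  have "anc k v \<in> V \<and> dep (anc k v) = dep v - k"
    using assms
  proof (induction k arbitrary: v)
    case (Suc k)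
    then have "v \<noteq> root" using depth_root by auto
    then obtain u where u: "par E v = Some u"
      using parent_exists Suc.prems by blast
    show ?case
      using Suc.IH[of u] Suc.prems depth_child[OF u] par_pow_Suc_shift[OF u, of k] by (simp del: par_pow.simps)
  qed simp
  then show "anc k v \<in> V" "dep (anc k v) = dep v - k" by auto
qed

lemma anc_depth: "v \<in> V \<Longrightarrow> anc (dep v) v = root"
  by (simp add: par_pow_depth)

text \<open>Depth drops by one per step upwards, so a given ancestor is met for a single
  \<open>k\<close>. Hence at most one term of \<open>Gam \<phi> (unit_vec u) v\<close>
  survives.\<close>

lemma anc_eq_depth: "v \<in> V \<Longrightarrow> k \<le> dep v \<Longrightarrow> anc k v = u \<Longrightarrow> k = dep v - dep u"
  using ancestor(2)[of v k] by auto

lemma path_weight_Suc: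
  assumes "par E v = Some u"
  shows "pw (Suc k) v = lam v * pw k u"
  unfolding path_weight_def prod.lessThan_Suc_shift
  using par_pow_Suc_shift[OF assms] by (simp del: par_pow.simps(2))

text \<open>The factors belong to \<open>anc n v\<close> with \<open>n < k\<close>, so the product
  stops before the root, whose weight is unconstrained.\<close>

lemma path_weight_nonzero:
  assumes "\<And>v. v \<in> V - {root} \<Longrightarrow> lam v \<noteq> 0" and v: "v \<in> V" "k \<le> dep v"
  shows "pw k v \<noteq> 0"
proof -
  have "anc n v \<in> V - {root}" if "n < k" for n
    using that ancestor[of v n] v depth_root by auto
  then show ?thesis
    unfolding path_weight_def using assms(1) by simp
qed

text \<open>Every level is inhabited, so that every coefficient of a multiplier shows up at some
  vertex.\<close>

lemma exists_vertex_of_depth: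
  assumes "leafless V E"
  obtains v where "v \<in> V" "dep v = n"
proof -
  have "\<exists>v\<in>V. dep v = n"
  proof (induction n)
    case 0
    show ?case using root_in_V depth_root by blast
  next
    case (Suc n)
    then obtain v where v: "v \<in> V" "dep v = n" by blast
    then obtain w where "(v, w) \<in> E"
      using assms by (auto simp: leafless_def Chi_def)
    then have w: "par E w = Some v" by (simp add: par_eq_Some_iff)
    show ?case using depth_child[OF w] v by auto
  qed
  with that show ?thesis by blast
qed

section \<open>The operators \<open>Gam \<phi>\<close> and polynomials in the shift\<close>

lemma Gamma_apply:
  "v \<in> V \<Longrightarrow> Gam \<phi> f v = (\<Sum>k\<le>dep v. of_real (pw k v) * \<phi> k * f (anc k v))"
  by (simp add: Gamma_op_def)

lemma Gamma_outside: "v \<notin> V \<Longrightarrow> Gam \<phi> f v = 0"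
  by (simp add: Gamma_op_def)

lemma Gamma_add: "Gam \<phi> (\<lambda>v. f v + g v) = (\<lambda>v. Gam \<phi> f v + Gam \<phi> g v)"
  by (auto simp: Gamma_op_def distrib_left sum.distrib)

lemma Gamma_scale: "Gam \<phi> (\<lambda>v. c * f v) = (\<lambda>v. c * Gam \<phi> f v)"
  by (auto simp: Gamma_op_def sum_distrib_left mult_ac)

lemma multipliers_iff: "\<phi> \<in> multipliers V E lam \<longleftrightarrow> (\<forall>f\<in>ell2 V. Gam \<phi> f \<in> ell2 V)"
  by (auto simp: multipliers_def mult_dom_def)

lemma mult_op_eq: "\<phi> \<in> multipliers V E lam \<Longrightarrow> mult_op V E lam \<phi> = restrict (Gam \<phi>) (ell2 V)"
  by (simp add: mult_op_def multipliers_def)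

text \<open>The value at \<open>v\<close> involves only \<open>v\<close> and its ancestors, which
  are finitely many even when vertices have infinitely many children.\<close>

lemma row_finite_Gamma:
  assumes "\<phi> \<in> multipliers V E lam"
  shows "row_finite_operator V (Gam \<phi>) (\<lambda>v. (\<lambda>k. anc k v) ` {..dep v})"
proof
  show "Gam \<phi> f \<in> ell2 V" if "f \<in> ell2 V" for f
    using assms that by (simp add: multipliers_iff)
  show "(\<lambda>k. anc k v) ` {..dep v} \<subseteq> V" if "v \<in> V" for v
    using that ancestor by auto
  show "Gam \<phi> f v = Gam \<phi> g v"
    if "v \<in> V" "\<And>u. u \<in> (\<lambda>k. anc k v) ` {..dep v} \<Longrightarrow> f u = g u" for f g v
    using that by (simp add: Gamma_apply)
qed (simp_all add: Gamma_add Gamma_scale)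

lemma Gamma_bounded:
  assumes "\<phi> \<in> multipliers V E lam"
  obtains C where "C \<ge> 0" "\<And>f. f \<in> ell2 V \<Longrightarrow> ell2_norm V (Gam \<phi> f) \<le> C * ell2_norm V f"
  using row_finite_operator.bounded[OF row_finite_Gamma[OF assms]] by blast

lemma mult_op_bounded:
  assumes "\<phi> \<in> multipliers V E lam"
  shows "mult_op V E lam \<phi> \<in> bounded_ops V"
proof -
  obtain C where C: "\<And>f. f \<in> ell2 V \<Longrightarrow> ell2_norm V (Gam \<phi> f) \<le> C * ell2_norm V f"
    using Gamma_bounded[OF assms] by blast
  show ?thesis
    unfolding bounded_ops_def mult_op_eq[OF assms]
    using assms C by (auto simp: multipliers_iff Gamma_add Gamma_scale ell2_add ell2_scale)
qed

text \<open>Each application of \<open>S\<close> moves the evaluation point to the parent and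
  collects a weight. Beyond \<open>dep v\<close> steps the value 0 of the shift at the root is
  hit.\<close>

lemma shift_power:
  assumes S: "S \<in> bounded_ops V" and f: "f \<in> ell2 V"
  shows "(S ^^ i) f \<in> ell2 V"
    and "v \<in> V \<Longrightarrow> (S ^^ i) f v = (if i \<le> dep v then of_real (pw i v) * f (anc i v) else 0)"
proof -
  show ell2: "(S ^^ i) f \<in> ell2 V" for i
    using S f by (induction i) (auto simp: bounded_ops_def)
  show "(S ^^ i) f v = (if i \<le> dep v then of_real (pw i v) * f (anc i v) else 0)" if "v \<in> V" for v
    using that
  proof (induction i arbitrary: v)
    case 0
    then show ?case by (simp add: path_weight_def)
  next
    case (Suc i)
    have step: "(S ^^ Suc i) f v = (if v \<noteq> root then of_real (lam v) * (S ^^ i) f (the (par E v)) else 0)"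
      using Suc.prems ell2[of i] by (simp add: weighted_shift_def)
    show ?case
    proof (cases "v = root")
      case True
      then show ?thesis using step by (simp add: depth_root)
    next
      case False
      then obtain u where u: "par E v = Some u"
        using parent_exists Suc.prems by blast
      show ?thesis
        using step False Suc.IH[of u] u depth_child[OF u] path_weight_Suc[OF u, of i] par_pow_Suc_shift[OF u, of i]
        by (simp del: par_pow.simps)
    qed
  qed
qed

lemma poly_op_eq_Gamma:
  assumes S: "S \<in> bounded_ops V"
  shows "coeff p \<in> multipliers V E lam" "poly_op V S p = mult_op V E lam (coeff p)"
proof -
  have eq: "(\<lambda>v. \<Sum>i\<le>degree p. coeff p i * (S ^^ i) f v) = Gam (coeff p) f" if f: "f \<in> ell2 V" for f
  proof
    fix v
    show "(\<Sum>i\<le>degree p. coeff p i * (S ^^ i) f v) = Gam (coeff p) f v"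
    proof (cases "v \<in> V")
      case True
      \<comment> \<open>The sum is extended past the degree, where coefficients vanish, and then cut
        at \<open>dep v\<close>, where the powers of \<open>S\<close> start to vanish at
        \<open>v\<close>.\<close>
      have "(\<Sum>i\<le>degree p. coeff p i * (S ^^ i) f v)
        = (\<Sum>i\<le>max (degree p) (dep v). coeff p i * (S ^^ i) f v)"
        by (rule sum.mono_neutral_left) (auto simp: coeff_eq_0)
      also have "\<dots> = (\<Sum>i\<le>dep v. coeff p i * (S ^^ i) f v)"
        by (rule sum.mono_neutral_right) (auto simp: shift_power(2)[OF S f True])
      also have "\<dots> = Gam (coeff p) f v"
        by (auto simp: shift_power(2)[OF S f True] Gamma_apply[OF True] intro!: sum.cong)
      finally show ?thesis .
    next
      case False
      then show ?thesis
        using ell2_outside[OF shift_power(1)[OF S f]] by (simp add: Gamma_outside)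
    qed
  qed
  have "Gam (coeff p) f \<in> ell2 V" if f: "f \<in> ell2 V" for f
    unfolding eq[OF f, symmetric]
    using ell2_sum[of "{..degree p}" "\<lambda>i v. coeff p i * (S ^^ i) f v" V]
      ell2_scale(1)[OF shift_power(1)[OF S f]] by blast
  then show p: "coeff p \<in> multipliers V E lam"
    by (simp add: multipliers_iff)
  show "poly_op V S p = mult_op V E lam (coeff p)"
    unfolding mult_op_eq[OF p] poly_op_def using eq by (auto intro!: restrict_ext)
qed

section \<open>Fejer means and their uniform bound\<close>

text \<open>Since \<open>real (Suc n - k)\<close> vanishes for \<open>k > n\<close>, these are the coefficients of the Fejer means
  of the power series with coefficients \<open>\<phi>\<close>.\<close>

definition fejer :: "(nat \<Rightarrow> complex) \<Rightarrow> nat \<Rightarrow> nat \<Rightarrow> complex"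
  where "fejer \<phi> n k = of_real (real (Suc n - k) / real (Suc n)) * \<phi> k"

lemma fejer_eq_coeff:
  obtains p where "coeff p = fejer \<phi> n"
proof
  show "coeff (\<Sum>k\<le>n. monom (fejer \<phi> n k) k) = fejer \<phi> n"
    by (rule ext) (auto simp: coeff_sum fejer_def)
qed

text \<open>The index \<open>a\<close> is the deepest level of the window. Windows may stick out
  above the root, so even vertices near the root lie in \<open>n + 1\<close> of them, namely for
  \<open>a\<close> from \<open>dep u\<close> to \<open>dep u + n\<close>.\<close>

definition window :: "nat \<Rightarrow> nat \<Rightarrow> 'v set"
  where "window n a = {u. dep u \<le> a \<and> a \<le> dep u + n}"

text \<open>Each pair of vertices whose depths differ by \<open>k\<close> lies in \<open>Suc n - k\<close> common windows; the
  Fejer mean is therefore an average of compressions of \<open>\<Gamma>\<close>.\<close>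

lemma Gamma_fejer_eq_sum_windows:
  assumes v: "v \<in> V"
  shows "of_nat (Suc n) * Gam (fejer \<phi> n) f v
    = (\<Sum>a\<in>{dep v..dep v + n}. Gam \<phi> (cutoff (window n a) f) v)"
proof -
  have count: "(\<Sum>a\<in>{dep v..dep v + n}. of_real (pw k v) * \<phi> k * cutoff (window n a) f (anc k v))
      = of_nat (Suc n) * (of_real (pw k v) * fejer \<phi> n k * f (anc k v))" if k: "k \<le> dep v" for k
  proof -
    \<comment> \<open>The ancestor has depth \<open>dep v - k\<close>, so it lies in window
      \<open>a\<close> as long as \<open>a + k \<le> dep v + n\<close>. For \<open>k > n\<close> the
      truncated subtraction gives the empty range.\<close>
    have "(\<Sum>a\<in>{dep v..dep v + n}. of_real (pw k v) * \<phi> k * cutoff (window n a) f (anc k v))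
      = (\<Sum>a\<in>{dep v..<dep v + (Suc n - k)}. of_real (pw k v) * \<phi> k * f (anc k v))"
      using k by (intro sum.mono_neutral_cong_right) (auto simp: cutoff_def window_def ancestor(2)[OF v k])
    also have "\<dots> = of_nat (Suc n - k) * (of_real (pw k v) * \<phi> k * f (anc k v))"
      by (simp only: sum_constant card_atLeastLessThan add_diff_cancel_left')
    also have "\<dots> = of_nat (Suc n) * (of_real (pw k v) * fejer \<phi> n k * f (anc k v))"
      by (simp add: fejer_def del: of_nat_Suc)
    finally show ?thesis .
  qed
  show ?thesis
    unfolding Gamma_apply[OF v] sum_distrib_left
    by (subst sum.swap, intro sum.cong refl count[symmetric]) simp
qed

text \<open>Each vertex is counted by at most \<open>n + 1\<close> of the windows.\<close>

lemma sum_window_norms: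
  assumes f: "f \<in> ell2 V"
  shows "(\<Sum>a\<le>N. (ell2_norm V (cutoff (window n a) f))\<^sup>2) \<le> real (Suc n) * (ell2_norm V f)\<^sup>2"
proof -
  let ?h = "\<lambda>a v. (cmod (cutoff (window n a) f v))\<^sup>2"
  have s: "?h a summable_on V" for a
    using cutoff_ell2(1)[OF f] by (simp add: ell2_def)
  have sf: "(\<lambda>v. (cmod (f v))\<^sup>2) summable_on V"
    using f by (simp add: ell2_def)
  have hs: "((\<lambda>v. \<Sum>a\<le>N. ?h a v) has_sum (\<Sum>a\<le>N. infsum (?h a) V)) V"
  proof (induction N)
    case (Suc N)
    then show ?case using has_sum_add[OF Suc has_sum_infsum[OF s[of "Suc N"]]] by simp
  qed (simp add: s)
  have "(\<Sum>a\<le>N. infsum (?h a) V) \<le> real (Suc n) * (\<Sum>\<^sub>\<infinity>v\<in>V. (cmod (f v))\<^sup>2)"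
  proof (rule has_sum_mono[OF hs])
    show "((\<lambda>v. real (Suc n) * (cmod (f v))\<^sup>2) has_sum real (Suc n) * (\<Sum>\<^sub>\<infinity>v\<in>V. (cmod (f v))\<^sup>2)) V"
      by (intro has_sum_cmult_right has_sum_infsum sf)
    fix v assume "v \<in> V"
    have "(\<Sum>a\<le>N. ?h a v) = (\<Sum>a\<in>{..N} \<inter> {dep v..dep v + n}. (cmod (f v))\<^sup>2)"
      by (rule sum.mono_neutral_cong_right) (auto simp: cutoff_def window_def)
    also have "\<dots> \<le> (\<Sum>a\<in>{dep v..dep v + n}. (cmod (f v))\<^sup>2)"
      by (rule sum_mono2) auto
    finally show "(\<Sum>a\<le>N. ?h a v) \<le> real (Suc n) * (cmod (f v))\<^sup>2"
      by simp
  qed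
  then show ?thesis by (simp add: ell2_norm_power2)
qed

text \<open>Cauchy-Schwarz over the \<open>n + 1\<close> windows through \<open>v\<close> costs one
  factor \<open>n + 1\<close>, and the overlap of the windows costs another. The square of the
  averaging factor cancels both, so \<open>C\<close> is preserved for every
  \<open>n\<close>.\<close>

lemma fejer_norm_bound:
  assumes C: "C \<ge> 0" "\<And>f. f \<in> ell2 V \<Longrightarrow> ell2_norm V (Gam \<phi> f) \<le> C * ell2_norm V f"
    and \<phi>: "\<phi> \<in> multipliers V E lam" and f: "f \<in> ell2 V"
  shows "Gam (fejer \<phi> n) f \<in> ell2 V \<and> ell2_norm V (Gam (fejer \<phi> n) f) \<le> C * ell2_norm V f"
proof -
  have "L2_set (\<lambda>v. cmod (Gam (fejer \<phi> n) f v)) F \<le> C * ell2_norm V f" if F: "finite F" "F \<subseteq> V" for F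
  proof -
    let ?x = "\<lambda>a v. cmod (Gam \<phi> (cutoff (window n a) f) v)"
    \<comment> \<open>All windows through vertices of \<open>F\<close> have index at most
      \<open>N\<close>; the inserted 0 covers empty \<open>F\<close>.\<close>
    define N where "N = Max (insert 0 (dep ` F)) + n"
    have N: "dep v + n \<le> N" if "v \<in> F" for v
      using that F(1) by (auto simp: N_def)
    have pointwise: "real (Suc n) * (cmod (Gam (fejer \<phi> n) f v))\<^sup>2 \<le> (\<Sum>a\<le>N. (?x a v)\<^sup>2)" if v: "v \<in> F" for v
    proof -
      have "real (Suc n) * cmod (Gam (fejer \<phi> n) f v) = cmod (of_nat (Suc n) * Gam (fejer \<phi> n) f v)"
        by (simp add: norm_mult del: of_nat_Suc)
      also have "\<dots> \<le> (\<Sum>a\<in>{dep v..dep v + n}. ?x a v)"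
        using v F by (subst Gamma_fejer_eq_sum_windows) (auto intro: norm_sum)
      finally have "(real (Suc n) * cmod (Gam (fejer \<phi> n) f v))\<^sup>2 \<le> (\<Sum>a\<in>{dep v..dep v + n}. ?x a v)\<^sup>2"
        by (intro power_mono) auto
      also have "\<dots> \<le> (\<Sum>a\<in>{dep v..dep v + n}. (?x a v)\<^sup>2) * real (Suc n)"
        using sum_squared_le_sum_of_squares[of "\<lambda>a. ?x a v" "{dep v..dep v + n}"] by simp
      \<comment> \<open>Nonnegative terms are added to make the index range independent of
        \<open>v\<close>, which allows the sums over \<open>v\<close> and \<open>a\<close> to be
        exchanged.\<close>
      also have "(\<Sum>a\<in>{dep v..dep v + n}. (?x a v)\<^sup>2) \<le> (\<Sum>a\<le>N. (?x a v)\<^sup>2)"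
        using N[OF v] by (intro sum_mono2) auto
      finally have "real (Suc n) * (real (Suc n) * (cmod (Gam (fejer \<phi> n) f v))\<^sup>2)
          \<le> real (Suc n) * (\<Sum>a\<le>N. (?x a v)\<^sup>2)"
        by (simp add: power2_eq_square mult_ac del: of_nat_Suc)
      then show ?thesis by (simp del: of_nat_Suc)
    qed
    have c: "cutoff (window n a) f \<in> ell2 V" for a
      using cutoff_ell2(1)[OF f] .
    have "real (Suc n) * (\<Sum>v\<in>F. (cmod (Gam (fejer \<phi> n) f v))\<^sup>2) \<le> (\<Sum>v\<in>F. \<Sum>a\<le>N. (?x a v)\<^sup>2)"
      unfolding sum_distrib_left by (intro sum_mono pointwise)
    also have "\<dots> = (\<Sum>a\<le>N. (L2_set (?x a) F)\<^sup>2)"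
      by (subst sum.swap) (simp add: L2_set_def sum_nonneg)
    also have "\<dots> \<le> (\<Sum>a\<le>N. (C * ell2_norm V (cutoff (window n a) f))\<^sup>2)"
      using \<phi> c by (intro sum_mono power_mono order_trans[OF L2_set_le_ell2_norm C(2)] F)
        (auto simp: multipliers_iff)
    also have "\<dots> = C\<^sup>2 * (\<Sum>a\<le>N. (ell2_norm V (cutoff (window n a) f))\<^sup>2)"
      by (simp add: power_mult_distrib sum_distrib_left)
    also have "\<dots> \<le> C\<^sup>2 * (real (Suc n) * (ell2_norm V f)\<^sup>2)"
      by (intro mult_left_mono sum_window_norms f) auto
    also have "\<dots> = real (Suc n) * (C * ell2_norm V f)\<^sup>2"
      by (simp add: power_mult_distrib)
    finally have "(\<Sum>v\<in>F. (cmod (Gam (fejer \<phi> n) f v))\<^sup>2) \<le> (C * ell2_norm V f)\<^sup>2"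
      by (simp del: of_nat_Suc)
    then show ?thesis
      unfolding L2_set_def using C(1) by (auto intro!: real_le_lsqrt sum_nonneg)
  qed
  then show ?thesis
    using ell2_bounded[of V "Gam (fejer \<phi> n) f" "C * ell2_norm V f"] by (auto simp: Gamma_outside)
qed

text \<open>Only \<open>k = dep v - dep u\<close> can contribute, so the Fejer factor comes out of
  the sum; if \<open>u\<close> is not an ancestor of \<open>v\<close> both sides are 0.\<close>

lemma fejer_unit_vec:
  assumes v: "v \<in> V"
  shows "Gam (fejer \<phi> n) (unit_vec u) v
    = of_real (real (Suc n - (dep v - dep u)) / real (Suc n)) * Gam \<phi> (unit_vec u) v"
  unfolding Gamma_apply[OF v] sum_distrib_left
  using anc_eq_depth[OF v] by (intro sum.cong) (auto simp: fejer_def unit_vec_def)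

lemma fejer_tendsto_unit_vec:
  assumes \<phi>: "\<phi> \<in> multipliers V E lam" and u: "u \<in> V"
  shows "(\<lambda>n. ell2_norm V (\<lambda>v. Gam (fejer \<phi> n) (unit_vec u) v - Gam \<phi> (unit_vec u) v)) \<longlonglongrightarrow> 0"
proof -
  \<comment> \<open>The relative error of the mean at \<open>v\<close>. It is at most
    \<open>1\<close> and tends to 0 for each \<open>v\<close>, but the rate depends on the depth of
    \<open>v\<close>; hence dominated convergence.\<close>
  define c where "c n v = real (Suc n - (dep v - dep u)) / real (Suc n) - 1" for n v
  have c_bounds: "\<bar>c n v\<bar> \<le> real (dep v - dep u) / real (Suc n)" "\<bar>c n v\<bar> \<le> 1" for n v
  proof -
    have "\<bar>c n v\<bar> = (real (Suc n) - real (Suc n - (dep v - dep u))) / real (Suc n)"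
      by (simp add: c_def diff_divide_distrib del: of_nat_Suc)
    also have "\<dots> \<le> real (dep v - dep u) / real (Suc n)"
      by (intro divide_right_mono) linarith+
    finally show "\<bar>c n v\<bar> \<le> real (dep v - dep u) / real (Suc n)" .
    show "\<bar>c n v\<bar> \<le> 1"
      by (simp add: c_def abs_le_iff del: of_nat_Suc)
  qed
  have "(\<lambda>n. ell2_norm V (\<lambda>v. of_real (c n v) * Gam \<phi> (unit_vec u) v)) \<longlonglongrightarrow> 0"
  proof (rule ell2_dominated_convergence)
    show "Gam \<phi> (unit_vec u) \<in> ell2 V"
      using \<phi> unit_vec_ell2[OF u] by (simp add: multipliers_iff)
    show "cmod (of_real (c n v)) \<le> 1" for n v
      using c_bounds[of n v] by simp
    fix v
    have "(\<lambda>n. c n v) \<longlonglongrightarrow> 0"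
    proof (rule Lim_null_comparison)
      show "\<forall>\<^sub>F n in sequentially. norm (c n v) \<le> real (dep v - dep u) * inverse (real (Suc n))"
        using c_bounds by (simp add: divide_inverse)
      show "(\<lambda>n. real (dep v - dep u) * inverse (real (Suc n))) \<longlonglongrightarrow> 0"
        using tendsto_mult_right_zero[OF LIMSEQ_inverse_real_of_nat] .
    qed
    then show "(\<lambda>n. complex_of_real (c n v)) \<longlonglongrightarrow> 0"
      using tendsto_of_real[of "\<lambda>n. c n v" 0] by simp
  qed
  moreover have "(\<lambda>v. of_real (c n v) * Gam \<phi> (unit_vec u) v)
      = (\<lambda>v. Gam (fejer \<phi> n) (unit_vec u) v - Gam \<phi> (unit_vec u) v)" for n
  proof
    fix v
    show "of_real (c n v) * Gam \<phi> (unit_vec u) v = Gam (fejer \<phi> n) (unit_vec u) v - Gam \<phi> (unit_vec u) v"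
      by (cases "v \<in> V") (simp_all add: fejer_unit_vec Gamma_outside c_def left_diff_distrib)
  qed
  ultimately show ?thesis by simp
qed

end

section \<open>Operator topologies\<close>

text \<open>Eventual membership passes to finite intersections and to unions, so it need be checked
  on generating sets only.\<close>

lemma in_closure_of_generated:
  assumes T: "T \<in> topspace (topology_generated_by B)" and K: "\<And>n. \<sigma> n \<in> K"
    and conv: "\<And>U. U \<in> B \<Longrightarrow> T \<in> U \<Longrightarrow> \<forall>\<^sub>F n in sequentially. \<sigma> n \<in> U"
  shows "T \<in> topology_generated_by B closure_of K"
  unfolding in_closure_of
proof (intro conjI allI impI)
  fix U assume U: "T \<in> U \<and> openin (topology_generated_by B) U"
  then have "generate_topology_on B U" by (simp add: openin_topology_generated_by_iff)
  then have "T \<in> U \<Longrightarrow> \<forall>\<^sub>F n in sequentially. \<sigma> n \<in> U"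
  proof (induction rule: generate_topology_on.induct)
    case (Int a b)
    then show ?case by (auto intro: eventually_conj)
  next
    case (UN K)
    then obtain k where k: "k \<in> K" "T \<in> k" by blast
    from UN.IH[OF this] show ?case by (rule eventually_mono) (use k in blast)
  qed (use conv in auto)
  then have "\<forall>\<^sub>F n in sequentially. \<sigma> n \<in> U" using U by blast
  then show "\<exists>y. y \<in> K \<and> y \<in> U"
    using K by (auto simp: eventually_sequentially)
qed (fact T)

lemma bounded_ops_ell2: "T \<in> bounded_ops V \<Longrightarrow> f \<in> ell2 V \<Longrightarrow> T f \<in> ell2 V"
  by (auto simp: bounded_ops_def)

lemma strong_limit_in_SOT_closure:
  assumes T: "T \<in> bounded_ops V" and \<sigma>: "\<And>n. \<sigma> n \<in> bounded_ops V" "\<And>n. \<sigma> n \<in> K"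
    and lim: "\<And>f. f \<in> ell2 V \<Longrightarrow> (\<lambda>n. ell2_norm V (\<lambda>v. \<sigma> n f v - T f v)) \<longlonglongrightarrow> 0"
  shows "T \<in> SOT V closure_of K"
  unfolding SOT_def
proof (rule in_closure_of_generated[where \<sigma> = \<sigma>, OF _ \<sigma>(2)], fold SOT_def)
  show "T \<in> topspace (SOT V)" using T by (simp add: topspace_SOT)
  fix U assume "U \<in> {{T \<in> bounded_ops V. ell2_norm V (\<lambda>v. T f v - A f v) < e} | A f e.
       A \<in> bounded_ops V \<and> f \<in> ell2 V \<and> e > 0}" and TU: "T \<in> U"
  then obtain A f e where A: "A \<in> bounded_ops V" and f: "f \<in> ell2 V"
    and U: "U = {T \<in> bounded_ops V. ell2_norm V (\<lambda>v. T f v - A f v) < e}" by blast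
  \<comment> \<open>The generating balls are centred at an arbitrary \<open>A\<close>; this is the
    room left around \<open>T\<close>.\<close>
  have "0 < e - ell2_norm V (\<lambda>v. T f v - A f v)" using TU U by simp
  from order_tendstoD(2)[OF lim[OF f] this]
  show "\<forall>\<^sub>F n in sequentially. \<sigma> n \<in> U"
  proof (rule eventually_mono)
    fix n assume n: "ell2_norm V (\<lambda>v. \<sigma> n f v - T f v) < e - ell2_norm V (\<lambda>v. T f v - A f v)"
    have "ell2_norm V (\<lambda>v. (\<sigma> n f v - T f v) + (T f v - A f v))
      \<le> ell2_norm V (\<lambda>v. \<sigma> n f v - T f v) + ell2_norm V (\<lambda>v. T f v - A f v)"
      by (rule ell2_add(2)[OF ell2_diff(1)[OF bounded_ops_ell2[OF \<sigma>(1) f] bounded_ops_ell2[OF T f]]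
            ell2_diff(1)[OF bounded_ops_ell2[OF T f] bounded_ops_ell2[OF A f]]])
    then show "\<sigma> n \<in> U" using n \<sigma>(1) by (simp add: U)
  qed
qed

text \<open>By Cauchy-Schwarz, strong convergence controls every functional defining the weak
  topology.\<close>

lemma strong_limit_in_WOT_closure:
  assumes T: "T \<in> bounded_ops V" and \<sigma>: "\<And>n. \<sigma> n \<in> bounded_ops V" "\<And>n. \<sigma> n \<in> K"
    and lim: "\<And>f. f \<in> ell2 V \<Longrightarrow> (\<lambda>n. ell2_norm V (\<lambda>v. \<sigma> n f v - T f v)) \<longlonglongrightarrow> 0"
  shows "T \<in> WOT V closure_of K"
  unfolding WOT_def
proof (rule in_closure_of_generated[where \<sigma> = \<sigma>, OF _ \<sigma>(2)], fold WOT_def)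
  show "T \<in> topspace (WOT V)" using T by (simp add: topspace_WOT)
  fix U assume "U \<in> {{T \<in> bounded_ops V. cmod (ell2_inner V (\<lambda>v. T f v - A f v) g) < e} | A f g e.
       A \<in> bounded_ops V \<and> f \<in> ell2 V \<and> g \<in> ell2 V \<and> e > 0}" and TU: "T \<in> U"
  then obtain A f g e where A: "A \<in> bounded_ops V" and f: "f \<in> ell2 V" and g: "g \<in> ell2 V"
    and U: "U = {T \<in> bounded_ops V. cmod (ell2_inner V (\<lambda>v. T f v - A f v) g) < e}" by blast
  have pos: "0 < e - cmod (ell2_inner V (\<lambda>v. T f v - A f v) g)" using TU U by simp
  have "(\<lambda>n. ell2_norm V (\<lambda>v. \<sigma> n f v - T f v) * ell2_norm V g) \<longlonglongrightarrow> 0"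
    using tendsto_mult_left_zero[OF lim[OF f]] .
  from order_tendstoD(2)[OF this pos]
  show "\<forall>\<^sub>F n in sequentially. \<sigma> n \<in> U"
  proof (rule eventually_mono)
    fix n assume n: "ell2_norm V (\<lambda>v. \<sigma> n f v - T f v) * ell2_norm V g
      < e - cmod (ell2_inner V (\<lambda>v. T f v - A f v) g)"
    have e2: "(\<lambda>v. \<sigma> n f v - T f v) \<in> ell2 V" "(\<lambda>v. T f v - A f v) \<in> ell2 V"
      by (rule ell2_diff(1)[OF bounded_ops_ell2[OF \<sigma>(1) f] bounded_ops_ell2[OF T f]],
          rule ell2_diff(1)[OF bounded_ops_ell2[OF T f] bounded_ops_ell2[OF A f]])
    have "ell2_inner V (\<lambda>v. (\<sigma> n f v - T f v) + (T f v - A f v)) g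
      = ell2_inner V (\<lambda>v. \<sigma> n f v - T f v) g + ell2_inner V (\<lambda>v. T f v - A f v) g"
      by (rule ell2_inner_add[OF e2 g])
    then have "cmod (ell2_inner V (\<lambda>v. \<sigma> n f v - A f v) g)
      \<le> cmod (ell2_inner V (\<lambda>v. \<sigma> n f v - T f v) g) + cmod (ell2_inner V (\<lambda>v. T f v - A f v) g)"
      using norm_triangle_ineq by simp
    then show "\<sigma> n \<in> U"
      using n ell2_inner_bound[OF e2(1) g] \<sigma>(1) by (simp add: U)
  qed
qed

section \<open>Continuity of coordinate evaluations\<close>

text \<open>Common core for both topologies: only the neighbourhoods that control a single
  coordinate differ.\<close>

lemma continuous_map_coordinate:
  assumes top: "topspace X = bounded_ops V"
    and open_nbhd: "\<And>A e. A \<in> bounded_ops V \<Longrightarrow> e > 0 \<Longrightarrow>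
      \<exists>N. openin X N \<and> A \<in> N \<and> (\<forall>T\<in>N. cmod (T f v - A f v) < e)"
  shows "continuous_map X euclidean (\<lambda>T. T f v)"
  unfolding continuous_map_def
proof (intro conjI allI impI)
  fix U :: "complex set" assume "openin euclidean U"
  then have U: "open U" by simp
  show "openin X {T \<in> topspace X. T f v \<in> U}"
  proof (subst openin_subopen, safe)
    fix A assume A: "A \<in> topspace X" "A f v \<in> U"
    obtain e where e: "e > 0" "\<And>z. dist z (A f v) < e \<Longrightarrow> z \<in> U"
      using U A(2) by (auto simp: open_dist)
    obtain N where N: "openin X N" "A \<in> N" "\<forall>T\<in>N. cmod (T f v - A f v) < e"
      using open_nbhd[of A e] A(1) e(1) top by auto
    show "\<exists>N. openin X N \<and> A \<in> N \<and> N \<subseteq> {T \<in> topspace X. T f v \<in> U}"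
      using N e(2) openin_subset[OF N(1)] by (intro exI[of _ N]) (auto simp: dist_norm)
  qed
qed simp

lemma continuous_map_SOT_coordinate:
  assumes f: "f \<in> ell2 V"
  shows "continuous_map (SOT V) euclidean (\<lambda>T. T f v)"
proof (rule continuous_map_coordinate[OF topspace_SOT])
  fix A and e :: real assume A: "A \<in> bounded_ops V" and e: "e > 0"
  let ?N = "{T \<in> bounded_ops V. ell2_norm V (\<lambda>v. T f v - A f v) < e}"
  have "openin (SOT V) ?N"
    unfolding SOT_def using A f e by (intro topology_generated_by_Basis) blast
  moreover have "cmod (T f v - A f v) < e" if "T \<in> ?N" for T
    using that cmod_le_ell2_norm[OF ell2_diff(1)[OF bounded_ops_ell2[OF _ f] bounded_ops_ell2[OF A f]], of T v]
    by simp
  ultimately show "\<exists>N. openin (SOT V) N \<and> A \<in> N \<and> (\<forall>T\<in>N. cmod (T f v - A f v) < e)"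
    using A e by (intro exI[of _ ?N]) (auto simp: ell2_norm_def)
qed

lemma continuous_map_WOT_coordinate:
  assumes f: "f \<in> ell2 V" and v: "v \<in> V"
  shows "continuous_map (WOT V) euclidean (\<lambda>T. T f v)"
proof (rule continuous_map_coordinate[OF topspace_WOT])
  fix A and e :: real assume A: "A \<in> bounded_ops V" and e: "e > 0"
  let ?N = "{T \<in> bounded_ops V. cmod (ell2_inner V (\<lambda>v. T f v - A f v) (unit_vec v)) < e}"
  have "openin (WOT V) ?N"
    unfolding WOT_def using A f e unit_vec_ell2[OF v] by (intro topology_generated_by_Basis) blast
  then show "\<exists>N. openin (WOT V) N \<and> A \<in> N \<and> (\<forall>T\<in>N. cmod (T f v - A f v) < e)"
    using A e v by (intro exI[of _ ?N]) (simp add: ell2_inner_unit_vec)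
qed

section \<open>Strong approximation and weak limits\<close>

context weighted_rooted_tree
begin

text \<open>The differences are bounded by \<open>2 * C\<close> uniformly in \<open>n\<close>, so
  convergence on unit vectors extends to their finite combinations and from there, by approximation,
  to all of \<open>ell2 V\<close>.\<close>

lemma fejer_tendsto:
  assumes \<phi>: "\<phi> \<in> multipliers V E lam" and f: "f \<in> ell2 V"
  shows "(\<lambda>n. ell2_norm V (\<lambda>v. Gam (fejer \<phi> n) f v - Gam \<phi> f v)) \<longlonglongrightarrow> 0"
proof (rule LIMSEQ_I)
  fix e :: real assume e: "e > 0"
  obtain C where C: "C \<ge> 0" "\<And>f. f \<in> ell2 V \<Longrightarrow> ell2_norm V (Gam \<phi> f) \<le> C * ell2_norm V f"
    using Gamma_bounded[OF \<phi>] by blast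
  define D where "D n g = (\<lambda>v. Gam (fejer \<phi> n) g v - Gam \<phi> g v)" for n g
  have D: "D n g \<in> ell2 V" "ell2_norm V (D n g) \<le> 2 * C * ell2_norm V g" if g: "g \<in> ell2 V" for n g
  proof -
    have "Gam \<phi> g \<in> ell2 V" using \<phi> g by (simp add: multipliers_iff)
    from ell2_diff[OF fejer_norm_bound[OF C \<phi> g, THEN conjunct1, of n] this]
    show "D n g \<in> ell2 V" "ell2_norm V (D n g) \<le> 2 * C * ell2_norm V g"
      unfolding D_def using fejer_norm_bound[OF C \<phi> g, of n] C(2)[OF g] by simp_all
  qed
  \<comment> \<open>The summand 1 keeps the denominator positive when \<open>C = 0\<close> and makes
    \<open>2 * C * d < e / 2\<close> strict.\<close>
  define d where "d = e / (4 * C + 1)"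
  have d: "d > 0" "2 * C * d < e / 2"
    using e C(1) by (auto simp: d_def field_simps add_pos_nonneg add_nonneg_pos)
  obtain G where G: "finite G" "G \<subseteq> V" and tail: "ell2_norm V (\<lambda>v. f v - cutoff G f v) \<le> d"
    using ell2_norm_cutoff_diff_small[OF f d(1)] by blast
  have "(\<lambda>n. \<Sum>u\<in>G. cmod (f u) * ell2_norm V (D n (unit_vec u))) \<longlonglongrightarrow> (\<Sum>u\<in>G. cmod (f u) * 0)"
    unfolding D_def using G(2) by (intro tendsto_intros fejer_tendsto_unit_vec \<phi>) auto
  then have "(\<lambda>n. \<Sum>u\<in>G. cmod (f u) * ell2_norm V (D n (unit_vec u))) \<longlonglongrightarrow> 0" by simp
  from order_tendstoD(2)[OF this, of "e / 2"] e
  obtain N where N: "\<And>n. n \<ge> N \<Longrightarrow> (\<Sum>u\<in>G. cmod (f u) * ell2_norm V (D n (unit_vec u))) < e / 2"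
    by (auto simp: eventually_sequentially)
  have "ell2_norm V (D n f) < e" if n: "n \<ge> N" for n
  proof -
    have D_add: "D n (\<lambda>v. g v + h v) = (\<lambda>v. D n g v + D n h v)" for g h
      by (auto simp: D_def Gamma_add)
    have D_scale: "D n (\<lambda>v. c * g v) = (\<lambda>v. c * D n g v)" for c g
      by (auto simp: D_def Gamma_scale right_diff_distrib)
    have "D n (\<lambda>v. \<Sum>u\<in>H. f u * unit_vec u v) = (\<lambda>v. \<Sum>u\<in>H. f u * D n (unit_vec u) v)" if "finite H" for H
      using that
    proof (induction H)
      case empty
      then show ?case using D_scale[of 0 "\<lambda>_. 0"] by simp
    qed (simp add: D_add D_scale)
    then have DG: "D n (cutoff G f) = (\<lambda>v. \<Sum>u\<in>G. f u * D n (unit_vec u) v)"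
      using G(1) by (simp add: cutoff_eq_sum_unit_vec)
    have u: "D n (unit_vec u) \<in> ell2 V" if "u \<in> G" for u
      using that G(2) by (auto intro!: D unit_vec_ell2)
    have "ell2_norm V (D n (cutoff G f)) \<le> (\<Sum>u\<in>G. ell2_norm V (\<lambda>v. f u * D n (unit_vec u) v))"
      using ell2_sum[OF G(1), of "\<lambda>u v. f u * D n (unit_vec u) v"] u by (simp add: DG ell2_scale)
    also have "\<dots> \<le> (\<Sum>u\<in>G. cmod (f u) * ell2_norm V (D n (unit_vec u)))"
      using u by (intro sum_mono ell2_scale(2)) auto
    finally have head: "ell2_norm V (D n (cutoff G f)) < e / 2"
      using N[OF n] by simp
    have r: "(\<lambda>v. f v - cutoff G f v) \<in> ell2 V"
      by (intro ell2_diff f cutoff_ell2)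
    have "ell2_norm V (D n (\<lambda>v. f v - cutoff G f v)) \<le> 2 * C * d"
      using D(2)[OF r, of n] mult_left_mono[OF tail, of "2 * C"] C(1) by linarith
    moreover have "D n f = (\<lambda>v. D n (cutoff G f) v + D n (\<lambda>v. f v - cutoff G f v) v)"
      using D_add[of "cutoff G f" "\<lambda>v. f v - cutoff G f v"] by simp
    then have "ell2_norm V (D n f)
      \<le> ell2_norm V (D n (cutoff G f)) + ell2_norm V (D n (\<lambda>v. f v - cutoff G f v))"
      using ell2_add(2)[OF D(1)[OF cutoff_ell2(1)[OF f]] D(1)[OF r]] by simp
    ultimately show ?thesis using head d(2) by linarith
  qed
  then show "\<exists>N. \<forall>n\<ge>N. norm (ell2_norm V (\<lambda>v. Gam (fejer \<phi> n) f v - Gam \<phi> f v) - 0) < e"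
    unfolding D_def by auto
qed

text \<open>The Fejer means of the symbol serve as \<open>\<sigma>\<close>; one sequence then
  handles both closures.\<close>

lemma mult_algebra_strong_limit:
  assumes S: "S \<in> bounded_ops V" and T: "T \<in> mult_algebra V E lam"
  obtains \<sigma> where "\<And>n. \<sigma> n \<in> bounded_ops V" "\<And>n. \<sigma> n \<in> {poly_op V S p | p. True}"
    "\<And>f. f \<in> ell2 V \<Longrightarrow> (\<lambda>n. ell2_norm V (\<lambda>v. \<sigma> n f v - T f v)) \<longlonglongrightarrow> 0"
proof -
  obtain \<phi> where \<phi>: "\<phi> \<in> multipliers V E lam" and T: "T = mult_op V E lam \<phi>"
    using T by (auto simp: mult_algebra_def)
  have fejer: "fejer \<phi> n \<in> multipliers V E lam
      \<and> mult_op V E lam (fejer \<phi> n) \<in> {poly_op V S p | p. True}" for n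
  proof -
    obtain p where p: "coeff p = fejer \<phi> n" by (rule fejer_eq_coeff)
    from poly_op_eq_Gamma[OF S, of p] have "fejer \<phi> n \<in> multipliers V E lam"
      "mult_op V E lam (fejer \<phi> n) = poly_op V S p" by (simp_all add: p)
    then show ?thesis by blast
  qed
  show ?thesis
  proof
    show "mult_op V E lam (fejer \<phi> n) \<in> bounded_ops V" for n
      using fejer by (simp add: mult_op_bounded)
    show "mult_op V E lam (fejer \<phi> n) \<in> {poly_op V S p | p. True}" for n
      using fejer by blast
    show "(\<lambda>n. ell2_norm V (\<lambda>v. mult_op V E lam (fejer \<phi> n) f v - T f v)) \<longlonglongrightarrow> 0"
      if "f \<in> ell2 V" for f
      using that fejer fejer_tendsto[OF \<phi> that] by (simp add: T mult_op_eq \<phi>)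
  qed
qed

section \<open>Closed equations that characterize multiplication operators\<close>

text \<open>The coefficients of a multiplier can be read off the image of the unit vector at the root.
  Expressing them in this way turns \<open>T = M\<^sub>\<phi>\<close> into a family of equations between finitely many
  coordinates of \<open>T f\<close> and \<open>T\<close> applied to that unit vector, and these survive limits.\<close>

lemma closure_subset_mult_algebra:
  assumes S: "S \<in> bounded_ops V" and leafless: "leafless V E"
    and lam: "\<And>v. v \<in> V - {root} \<Longrightarrow> lam v \<noteq> 0"
    and top: "topspace X = bounded_ops V"
    and cont: "\<And>f v. f \<in> ell2 V \<Longrightarrow> v \<in> V \<Longrightarrow> continuous_map X euclidean (\<lambda>T. T f v)"
  shows "X closure_of {poly_op V S p | p. True} \<subseteq> mult_algebra V E lam"
proof
  fix T assume T: "T \<in> X closure_of {poly_op V S p | p. True}"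
  have Tb: "T \<in> bounded_ops V"
    using T closure_of_subset_topspace[of X] top by blast
  have "\<exists>v. v \<in> V \<and> dep v = k" for k
    using exists_vertex_of_depth[OF leafless, of k] by blast
  then obtain w where w: "\<And>k. w k \<in> V" "\<And>k. dep (w k) = k"
    by metis
  let ?e = "unit_vec root"
  have e: "?e \<in> ell2 V" using root_in_V by (rule unit_vec_ell2)
  \<comment> \<open>The candidate symbol of \<open>T\<close>. For \<open>T = Gam \<phi>\<close> the
    value at \<open>w k\<close> is \<open>pw k (w k) * \<phi> k\<close>, because only the root term
    survives; nonzero weights permit the division.\<close>
  define \<Phi> where "\<Phi> T k = T ?e (w k) / of_real (pw k (w k))" for T :: "('v \<Rightarrow> complex) \<Rightarrow> 'v \<Rightarrow> complex" and k
  have \<Phi>_Gamma: "Gam \<phi> ?e (w k) / of_real (pw k (w k)) = \<phi> k" for \<phi> k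
  proof -
    have "Gam \<phi> ?e (w k) = (\<Sum>j\<in>{k}. of_real (pw j (w k)) * \<phi> j * ?e (anc j (w k)))"
      unfolding Gamma_apply[OF w(1)]
      using anc_eq_depth[OF w(1), of _ k root] by (intro sum.mono_neutral_right) (auto simp: w unit_vec_def depth_root)
    also have "\<dots> = of_real (pw k (w k)) * \<phi> k"
      using anc_depth[OF w(1), of k] by (simp add: w unit_vec_def)
    finally show ?thesis
      using path_weight_nonzero[OF lam w(1), of k k] by (simp add: w)
  qed
  have eq: "T f v = Gam (\<Phi> T) f v" if f: "f \<in> ell2 V" and v: "v \<in> V" for f v
  proof -
    let ?Z = "{T \<in> topspace X. T f v - Gam (\<Phi> T) f v \<in> {0}}"
    have mult: "continuous_map X euclidean (\<lambda>T. c * g T)" if "continuous_map X euclidean g"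
      for c :: complex and g
      using continuous_map_compose[OF that, of euclidean "\<lambda>z. c * z"]
      by (simp add: o_def continuous_intros)
    \<comment> \<open>Expanded, the defect is a finite combination of coordinates of
      \<open>T f\<close> and \<open>T ?e\<close> with coefficients independent of \<open>T\<close>,
      so it is continuous and its zero set \<open>?Z\<close> is closed.\<close>
    have "continuous_map X euclidean
        (\<lambda>T. T f v - (\<Sum>k\<le>dep v. (of_real (pw k v) * f (anc k v) / of_real (pw k (w k))) * T ?e (w k)))"
      by (intro continuous_map_diff continuous_map_sum mult cont e f v w) simp
    then have "continuous_map X euclidean (\<lambda>T. T f v - Gam (\<Phi> T) f v)"
      by (simp add: Gamma_apply[OF v] \<Phi>_def mult_ac)
    then have "closedin X ?Z"
      by (rule closedin_continuous_map_preimage) simp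
    moreover have "{poly_op V S p | p. True} \<subseteq> ?Z"
    proof clarify
      fix p
      have "\<Phi> (poly_op V S p) = coeff p"
        using poly_op_eq_Gamma[OF S, of p] e by (auto simp: \<Phi>_def mult_op_eq \<Phi>_Gamma)
      then show "poly_op V S p \<in> topspace X \<and> poly_op V S p f v - Gam (\<Phi> (poly_op V S p)) f v \<in> {0}"
        using poly_op_eq_Gamma[OF S, of p] mult_op_bounded[of "coeff p"] f by (simp add: top mult_op_eq)
    qed
    ultimately have "X closure_of {poly_op V S p | p. True} \<subseteq> ?Z"
      by (intro closure_of_minimal)
    then show ?thesis using T by auto
  qed
  obtain \<phi> where TG: "\<And>f. f \<in> ell2 V \<Longrightarrow> T f = Gam \<phi> f"
  proof
    fix f assume f: "f \<in> ell2 V"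
    show "T f = Gam (\<Phi> T) f"
    proof
      fix v show "T f v = Gam (\<Phi> T) f v"
        using eq[OF f] ell2_outside[OF bounded_ops_ell2[OF Tb f]] by (cases "v \<in> V") (auto simp: Gamma_outside)
    qed
  qed
  have \<phi>: "\<phi> \<in> multipliers V E lam"
    using bounded_ops_ell2[OF Tb] by (simp add: multipliers_iff TG)
  \<comment> \<open>Both operators are \<open>undefined\<close> off \<open>ell2 V\<close>, so
    agreement on \<open>ell2 V\<close> is equality.\<close>
  have "T \<in> extensional (ell2 V)"
    using Tb by (simp add: bounded_ops_def PiE_iff)
  then have "T = mult_op V E lam \<phi>"
    unfolding mult_op_eq[OF \<phi>] by (rule extensionalityI) (simp_all add: TG)
  then show "T \<in> mult_algebra V E lam"
    unfolding mult_algebra_def using \<phi> by blast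
qed

end

theorem theorem7:
  fixes V :: "'v set" and E :: "('v \<times> 'v) set" and lam :: "'v \<Rightarrow> real"
  assumes "directed_tree V E" and "countable V" and "infinite V"
    and "rooted V E" and "leafless V E"
    and "\<forall>v \<in> V - {tree_root V E}. lam v > 0"
    and "weighted_shift V E lam \<in> bounded_ops V"
  shows "mult_algebra V E lam = SOT V closure_of {poly_op V (weighted_shift V E lam) p | p. True}
    \<and> mult_algebra V E lam = WOT V closure_of {poly_op V (weighted_shift V E lam) p | p. True}"
proof -
  interpret weighted_rooted_tree V E lam
    using assms by (simp add: weighted_rooted_tree_def weighted_rooted_tree_axioms_def)
  have lam: "lam v \<noteq> 0" if "v \<in> V - {root}" for v
    using assms(6) that by force
  note S = assms(7)
  let ?K = "{poly_op V S p | p. True}"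
  have limits: "T \<in> SOT V closure_of ?K" "T \<in> WOT V closure_of ?K" if T: "T \<in> mult_algebra V E lam" for T
  proof -
    obtain \<sigma> where \<sigma>: "\<And>n. \<sigma> n \<in> bounded_ops V" "\<And>n. \<sigma> n \<in> ?K"
      "\<And>f. f \<in> ell2 V \<Longrightarrow> (\<lambda>n. ell2_norm V (\<lambda>v. \<sigma> n f v - T f v)) \<longlonglongrightarrow> 0"
      by (rule mult_algebra_strong_limit[OF S T]) blast
    have T_bounded: "T \<in> bounded_ops V"
      using T by (auto simp: mult_algebra_def mult_op_bounded)
    show "T \<in> SOT V closure_of ?K"
      using T_bounded \<sigma> by (rule strong_limit_in_SOT_closure[where \<sigma> = \<sigma>])
    show "T \<in> WOT V closure_of ?K"
      using T_bounded \<sigma> by (rule strong_limit_in_WOT_closure[where \<sigma> = \<sigma>])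
  qed
  have SOT_sub: "SOT V closure_of ?K \<subseteq> mult_algebra V E lam"
    using S assms(5) lam topspace_SOT continuous_map_SOT_coordinate by (rule closure_subset_mult_algebra)
  have WOT_sub: "WOT V closure_of ?K \<subseteq> mult_algebra V E lam"
    using S assms(5) lam topspace_WOT continuous_map_WOT_coordinate by (rule closure_subset_mult_algebra)
  show ?thesis
    by (intro conjI subset_antisym[OF subsetI SOT_sub] subset_antisym[OF subsetI WOT_sub] limits)
qed

end
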